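(* For all integers $c\geq 0$ and $n\geq 0$, we have $$a_{121c+9}(121n+36)\equiv 0\pmod{11}$$ and $$d_{121c+4}(121n+96)\equiv 0\pmod{11}.$$
   Context: For a positive integer $m$, let $f_m := \prod_{k=1}^\infty (1-q^{mk})$, regarded as a formal power series in $q$ with integer coefficients (or as a function of $q\in\mathbb{C}$ with $|q|<1$). For an integer $k\geq 1$, $a_k(n)$ denotes the number of generalized cubic partitions of $n$, i.e. partitions of $n$ whose even parts may appear in $k$ different colors (odd parts have no restrictions and one color), with $a_k(0):=1$; its generating function is $$\sum_{n=0}^\infty a_k(n)q^n = \frac{1}{f_1f_2^{k-1}}.$$ For an integer $k\geq 1$, $d_k(n)$ denotes the number of partitions obtained by adding the links of the $k$-elongated plane partition diamonds of length $n$, with $d_k(0):=1$; for the purposes of this statement the integers $d_k(n)$ are determined by the generating function $$\sum_{n=0}^\infty d_k(n)q^n = \frac{f_2^k}{f_1^{3k+1}}.$$ *)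

theory Defs
  imports
    "HOL-Analysis.Infinite_Products"
    "HOL-Computational_Algebra.Formal_Power_Series"
    "HOL-Number_Theory.Cong"
begin

text \<open>
  A partition with coloured parts is a finite multiset of pairs (part, colour). In a generalized
  cubic partition with \<open>k\<close> colours, an even part carries one of the colours \<open>0, \<dots>, k - 1\<close>, while
  an odd part always carries the colour \<open>0\<close>.
\<close>

definition cubic_partitions :: "nat \<Rightarrow> nat \<Rightarrow> (nat \<times> nat) multiset set" where
  "cubic_partitions k n =
     {P. (\<forall>(p, c) \<in># P. p > 0 \<and> (if even p then c < k else c = 0)) \<and> (\<Sum>(p, c) \<in># P. p) = n}"

definition a_cubic :: "nat \<Rightarrow> nat \<Rightarrow> nat" where
  "a_cubic k n = card (cubic_partitions k n)"

text \<open>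
  The infinite product is a limit in the topology of coefficientwise convergence on formal power
  series; the index is shifted because \<^const>\<open>prodinf\<close> ranges over all natural numbers.
\<close>

definition f_prod :: "nat \<Rightarrow> int fps" where
  "f_prod m = (\<Prod>k. 1 - fps_X ^ (m * Suc k))"

text \<open>
  Since \<^typ>\<open>int\<close> is not a field, there is no division on \<^typ>\<open>int fps\<close>; \<open>fps_right_inverse g 1\<close> is
  the multiplicative inverse of a series \<open>g\<close> with constant coefficient \<open>1\<close>.
\<close>

definition d_diamond :: "nat \<Rightarrow> nat \<Rightarrow> int" where
  "d_diamond k n = fps_nth (f_prod 2 ^ k * fps_right_inverse (f_prod 1 ^ (3 * k + 1)) 1) n"

lemma f_prod_has_prod:
  assumes "m > 0"
  shows "(\<lambda>k. 1 - fps_X ^ (m * Suc k)) has_prod f_prod m" and "fps_nth (f_prod m) 0 = 1"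
proof -
  define P :: "nat \<Rightarrow> int fps" where "P = (\<lambda>n. \<Prod>i\<le>n. 1 - fps_X ^ (m * Suc i))"
  define L where "L = Abs_fps (\<lambda>n. fps_nth (P n) n)"
  have step: "fps_nth (P (Suc N)) n = fps_nth (P N) n" if "N \<ge> n" for N n
  proof -
    have "n < 1 * Suc (Suc N)"
      using that by simp
    also have "\<dots> \<le> m * Suc (Suc N)"
      using assms by (intro mult_right_mono) auto
    finally have less: "n < m * Suc (Suc N)" .
    have "P (Suc N) = P N - P N * fps_X ^ (m * Suc (Suc N))"
      unfolding P_def prod.atMost_Suc by (simp only: right_diff_distrib mult_1_right)
    then show ?thesis
      using less by (simp add: fps_X_power_mult_right_nth del: mult_Suc_right)
  qed
  have stable: "fps_nth (P N) n = fps_nth (P n) n" if "N \<ge> n" for N n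
    using that by (induction N rule: dec_induct) (auto simp: step)
  have lim: "P \<longlonglongrightarrow> L"
  proof (rule tendsto_fpsI)
    fix n
    show "eventually (\<lambda>N. fps_nth (P N) n = fps_nth L n) sequentially"
      using eventually_ge_at_top[of n] by eventually_elim (auto simp: L_def intro: stable)
  qed
  have "fps_nth L 0 = 1"
    using assms by (simp add: L_def P_def)
  then have "(\<lambda>k. 1 - fps_X ^ (m * Suc k)) has_prod L"
    using lim unfolding has_prod_def raw_has_prod_def P_def by force
  moreover from this have "f_prod m = L"
    unfolding f_prod_def by (rule has_prod_unique[symmetric])
  ultimately show "(\<lambda>k. 1 - fps_X ^ (m * Suc k)) has_prod f_prod m" "fps_nth (f_prod m) 0 = 1"
    using \<open>fps_nth L 0 = 1\<close> by simp_all
qed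

lemma d_diamond_generating_function: "Abs_fps (d_diamond k) * f_prod 1 ^ (3 * k + 1) = f_prod 2 ^ k"
proof -
  have "f_prod 1 ^ (3 * k + 1) * fps_right_inverse (f_prod 1 ^ (3 * k + 1)) 1 = 1"
    by (rule fps_right_inverse) (simp add: f_prod_has_prod fps_power_zeroth)
  moreover have "Abs_fps (d_diamond k) = f_prod 2 ^ k * fps_right_inverse (f_prod 1 ^ (3 * k + 1)) 1"
    by (simp add: fps_eq_iff d_diamond_def)
  ultimately show ?thesis
    by (simp only: mult.assoc mult.commute[of "fps_right_inverse _ _"] mult_1_right)
qed

end

theory Submission
  imports
    Defs
    "HOL-Computational_Algebra.Polynomial"
begin

text \<open>
  Write \<open>p\<^sub>m = 1 / f\<^sub>m\<close>. Modulo 11, where \<open>A\<^sup>1\<^sup>1(q) = A(q\<^sup>1\<^sup>1)\<close>, the two generating functions become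
  \<open>(f\<^sub>2\<^sup>2 / f\<^sub>1) f\<^sub>2 \<cdot> p\<^sub>2\<^sub>2\<close> and \<open>(f\<^sub>2\<^sup>2 / f\<^sub>1)\<^sup>2 \<cdot> p\<^sub>1\<^sub>1\<close>, up to a factor that is a series in
  \<open>q\<^sup>1\<^sup>2\<^sup>1\<close>. By the Jacobi triple product \<open>f\<^sub>2\<^sup>2 / f\<^sub>1\<close> and \<open>f\<^sub>2\<close> are theta series, so the leading
  factors are binary theta series of CM type, and in the residue class modulo 11 under consideration
  they are supported on a single class modulo 121. The index that is left for the partition numbers
  is then congruent to 6 modulo 11, and Ramanujan's congruence \<open>11 | p(11 n + 6)\<close> applies.
  For the latter (following Hirschhorn) one writes \<open>p = (f\<^sub>1\<^sup>3)\<^sup>7 / f\<^sub>1\<^sup>2\<^sup>2\<close> and splits Jacobi's series for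
  \<open>f\<^sub>1\<^sup>3\<close> according to residues modulo 11; the required vanishing follows from that of five components of
  \<open>f\<^sub>1\<^sup>1\<^sup>2 \<equiv> f\<^sub>1 f\<^sub>1\<^sub>1\<close>, which Euler's pentagonal number theorem provides.
\<close>

section \<open>Congruences of power series\<close>

text \<open>One relation serves several moduli: an integer, the constant series 11, and
  \<open>fps_X ^ n\<close>, for which it means agreement of the first \<open>n\<close>
  coefficients.\<close>

definition ring_cong :: "'a::comm_ring_1 \<Rightarrow> 'a \<Rightarrow> 'a \<Rightarrow> bool" where
  "ring_cong d a b \<longleftrightarrow> d dvd a - b"

lemma ring_cong_refl [simp]: "ring_cong d a a"
  by (simp add: ring_cong_def)

lemma ring_cong_sym: "ring_cong d a b \<Longrightarrow> ring_cong d b a"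
  unfolding ring_cong_def by (metis dvd_minus_iff minus_diff_eq)

lemma ring_cong_trans [trans]: "ring_cong d a b \<Longrightarrow> ring_cong d b c \<Longrightarrow> ring_cong d a c"
  unfolding ring_cong_def using dvd_add[of d "a - b" "b - c"] by simp

lemma ring_cong_add: "ring_cong d a b \<Longrightarrow> ring_cong d a' b' \<Longrightarrow> ring_cong d (a + a') (b + b')"
  unfolding ring_cong_def using dvd_add[of d "a - b" "a' - b'"] by (simp add: algebra_simps)

lemma ring_cong_diff: "ring_cong d a b \<Longrightarrow> ring_cong d a' b' \<Longrightarrow> ring_cong d (a - a') (b - b')"
  unfolding ring_cong_def using dvd_diff[of d "a - b" "a' - b'"] by (simp add: algebra_simps)

lemma ring_cong_mult:
  assumes "ring_cong d a b" "ring_cong d a' b'"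
  shows "ring_cong d (a * a') (b * b')"
proof -
  have "a * a' - b * b' = (a - b) * a' + b * (a' - b')"
    by (simp add: algebra_simps)
  then show ?thesis
    using assms unfolding ring_cong_def by simp
qed

lemma ring_cong_power: "ring_cong d a b \<Longrightarrow> ring_cong d (a ^ n) (b ^ n)"
  by (induction n) (auto intro: ring_cong_mult)

lemma ring_cong_sum: "(\<And>i. i \<in> S \<Longrightarrow> ring_cong d (f i) (g i)) \<Longrightarrow> ring_cong d (sum f S) (sum g S)"
  by (induction S rule: infinite_finite_induct) (auto intro: ring_cong_add)

lemma ring_cong_mono: "e dvd d \<Longrightarrow> ring_cong d a b \<Longrightarrow> ring_cong e a b"
  unfolding ring_cong_def by (rule dvd_trans)

lemma ring_cong_0_iff: "ring_cong d a 0 \<longleftrightarrow> d dvd a"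
  by (simp add: ring_cong_def)

lemma fps_X_power_dvd_iff:
  "fps_X ^ n dvd (A :: 'a::comm_ring_1 fps) \<longleftrightarrow> (\<forall>i<n. fps_nth A i = 0)"
proof
  assume *: "\<forall>i<n. fps_nth A i = 0"
  then have "A = fps_X ^ n * fps_shift n A"
    by (auto simp: fps_eq_iff fps_X_power_mult_nth)
  then show "fps_X ^ n dvd A"
    by (rule dvdI)
qed (auto simp: fps_X_power_mult_nth)

lemma ring_cong_fps_X_power_iff:
  "ring_cong (fps_X ^ n) A B \<longleftrightarrow> (\<forall>i<n. fps_nth A i = fps_nth B i)"
  by (simp add: ring_cong_def fps_X_power_dvd_iff)

lemma fps_eq_if_ring_cong: "(\<And>n. ring_cong (fps_X ^ n) A B) \<Longrightarrow> A = B"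
  unfolding ring_cong_fps_X_power_iff fps_eq_iff by blast

lemma fps_const_dvd_iff:
  "fps_const c dvd A \<longleftrightarrow> (\<forall>n. c dvd fps_nth A n)" for c :: "'a::comm_ring_1"
proof
  assume "\<forall>n. c dvd fps_nth A n"
  then obtain b where "\<And>n. fps_nth A n = c * b n"
    unfolding dvd_def by metis
  then have "A = fps_const c * Abs_fps b"
    by (simp add: fps_eq_iff)
  then show "fps_const c dvd A"
    by (rule dvdI)
qed (auto simp: dvd_def)

lemma numeral_fps_dvd_iff:
  "(numeral k :: 'a::comm_ring_1 fps) dvd A \<longleftrightarrow> (\<forall>n. numeral k dvd fps_nth A n)"
  by (simp add: numeral_fps_const fps_const_dvd_iff)

lemma fps_compose_X_power_nth:
  assumes "m > 0"
  shows "fps_nth (A oo fps_X ^ m) n = (if m dvd n then fps_nth A (n div m) else (0::'a::comm_ring_1))"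
proof -
  have "fps_nth (A oo fps_X ^ m) n = (\<Sum>i=0..n. if n = m * i then fps_nth A i else 0)"
    by (simp add: fps_compose_nth flip: power_mult cong: if_cong) (intro sum.cong refl, simp)
  also have "\<dots> = (if m dvd n then fps_nth A (n div m) else 0)"
  proof (cases "m dvd n")
    case True
    then have "(n = m * i) = (i = n div m)" for i
      using assms by auto
    then show ?thesis
      using True by simp
  next
    case False
    then show ?thesis
      by (auto intro!: sum.neutral)
  qed
  finally show ?thesis .
qed

text \<open>Expand \<open>(a + b)\<^sup>p\<close>: all the mixed binomial coefficients are divisible by \<open>p\<close>.\<close>
lemma ring_cong_add_power_prime:
  fixes a b :: "'a::comm_ring_1"
  assumes "prime p"
  shows "ring_cong (of_nat p) ((a + b) ^ p) (a ^ p + b ^ p)"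
proof -
  have p: "p > 0"
    using assms by (simp add: prime_gt_0_nat)
  have "(a + b) ^ p = (\<Sum>k\<le>p. of_nat (p choose k) * a ^ k * b ^ (p - k))"
    by (rule binomial_ring)
  also have "ring_cong (of_nat p) \<dots>
      (\<Sum>k\<le>p. if k = 0 \<or> k = p then of_nat (p choose k) * a ^ k * b ^ (p - k) else 0)"
  proof (intro ring_cong_sum)
    fix k assume "k \<in> {..p}"
    then consider "k = 0 \<or> k = p" | "k < p" "k \<noteq> 0"
      by force
    then show "ring_cong (of_nat p) (of_nat (p choose k) * a ^ k * b ^ (p - k))
        (if k = 0 \<or> k = p then of_nat (p choose k) * a ^ k * b ^ (p - k) else 0)"
    proof cases
      case 2
      then have "p dvd (p choose k)"
        using assms p by (intro dvd_choose_prime) auto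
      then obtain m where "p choose k = p * m" ..
      then show ?thesis
        using 2 by (simp add: ring_cong_def mult.assoc)
    qed auto
  qed
  also have "(\<Sum>k\<le>p. if k = 0 \<or> k = p then of_nat (p choose k) * a ^ k * b ^ (p - k) else 0)
      = (\<Sum>k\<in>{0, p}. of_nat (p choose k) * a ^ k * b ^ (p - k))"
    by (intro sum.mono_neutral_cong_right) auto
  also have "\<dots> = a ^ p + b ^ p"
    using p by simp
  finally show ?thesis .
qed

lemma int_power_prime_cong: "int p dvd c ^ p - c" if "prime p"
proof -
  have "int p dvd int k ^ p - int k" for k
  proof (induction k)
    case 0
    then show ?case
      using prime_gt_0_nat[OF that] by (simp add: zero_power)
  next
    case (Suc k)
    have "ring_cong (int p) ((int k + 1) ^ p) (int k ^ p + 1 ^ p)"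
      using ring_cong_add_power_prime[OF that, of "int k" 1] by simp
    also have "ring_cong (int p) \<dots> (int k + 1)"
      using Suc by (intro ring_cong_add) (auto simp: ring_cong_def)
    finally show ?case
      by (simp add: ring_cong_def add.commute)
  qed
  then have nonneg: "int p dvd c ^ p - c" if "c \<ge> 0" for c
    using \<open>int p dvd int (nat c) ^ p - int (nat c)\<close> that by simp
  show ?thesis
  proof (cases "c \<ge> 0")
    case False
    \<comment> \<open>Expanding the zero power of \<open>c + (- c)\<close> reduces to the
      nonnegative case without separating \<open>p = 2\<close> from odd \<open>p\<close>.\<close>
    have "ring_cong (int p) ((c + (- c)) ^ p) (c ^ p + (- c) ^ p)"
      using ring_cong_add_power_prime[OF that, of c "- c"] by simp
    from ring_cong_sym[OF this] have "int p dvd c ^ p + (- c) ^ p"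
      using prime_gt_0_nat[OF that] by (simp add: zero_power flip: ring_cong_0_iff)
    moreover have "int p dvd (- c) ^ p - (- c)"
      using False by (intro nonneg) auto
    ultimately have "int p dvd (c ^ p + (- c) ^ p) - ((- c) ^ p - (- c))"
      by (rule dvd_diff)
    then show ?thesis
      by simp
  qed (rule nonneg)
qed

text \<open>The Frobenius congruence. For polynomials it follows term by term from the binomial
  expansion and Fermat's little theorem; coefficient \<open>n\<close> on either side only depends on
  the coefficients of \<open>A\<close> up to \<open>n\<close>, so truncation suffices.\<close>

lemma fps_power_prime_cong:
  fixes A :: "int fps"
  assumes "prime p"
  shows "ring_cong (of_nat p) (A ^ p) (A oo fps_X ^ p)"
proof -
  have p: "p > 0"
    using assms by (simp add: prime_gt_0_nat)
  have trunc: "ring_cong (of_nat p) ((\<Sum>i<N. fps_const (fps_nth A i) * fps_X ^ i) ^ p)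
      (\<Sum>i<N. fps_const (fps_nth A i) * (fps_X ^ p) ^ i)" for N
  proof (induction N)
    case 0
    then show ?case
      using p by (simp add: zero_power)
  next
    case (Suc N)
    have "ring_cong (of_nat p) ((\<Sum>i<Suc N. fps_const (fps_nth A i) * fps_X ^ i) ^ p)
       ((\<Sum>i<N. fps_const (fps_nth A i) * fps_X ^ i) ^ p + (fps_const (fps_nth A N) * fps_X ^ N) ^ p)"
      using ring_cong_add_power_prime[OF assms] by simp
    also have "ring_cong (of_nat p) \<dots> ((\<Sum>i<N. fps_const (fps_nth A i) * (fps_X ^ p) ^ i)
        + fps_const (fps_nth A N) * (fps_X ^ p) ^ N)"
    proof (intro ring_cong_add Suc)
      have "(of_nat p :: int fps) dvd fps_const (fps_nth A N ^ p - fps_nth A N)"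
        using int_power_prime_cong[OF assms, of "fps_nth A N"]
        by (auto simp: fps_of_nat[symmetric] fps_const_dvd_iff)
      then have "ring_cong (of_nat p) (fps_const (fps_nth A N ^ p)) (fps_const (fps_nth A N))"
        by (simp add: ring_cong_def)
      then have "ring_cong (of_nat p) (fps_const (fps_nth A N ^ p) * (fps_X ^ N) ^ p)
          (fps_const (fps_nth A N) * (fps_X ^ N) ^ p)"
        by (intro ring_cong_mult) auto
      then show "ring_cong (of_nat p) ((fps_const (fps_nth A N) * fps_X ^ N) ^ p)
          (fps_const (fps_nth A N) * (fps_X ^ p) ^ N)"
        by (simp add: power_mult_distrib fps_const_power mult.commute[of N p] flip: power_mult)
    qed
    finally show ?case
      by simp
  qed
  have "int p dvd fps_nth (A ^ p - (A oo fps_X ^ p)) n" for n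
  proof -
    define T where "T = (\<Sum>i<Suc n. fps_const (fps_nth A i) * fps_X ^ i)"
    have "ring_cong (fps_X ^ Suc n) A T"
      unfolding ring_cong_fps_X_power_iff T_def
      by (auto simp: fps_sum_nth if_distrib[of "(*) _"] simp del: sum.lessThan_Suc cong: if_cong)
    then have "fps_nth (A ^ p) n = fps_nth (T ^ p) n"
      by (meson lessI ring_cong_fps_X_power_iff ring_cong_power)
    moreover have "fps_nth (A oo fps_X ^ p) n
        = fps_nth (\<Sum>i<Suc n. fps_const (fps_nth A i) * (fps_X ^ p) ^ i) n"
      by (simp add: fps_compose_nth fps_sum_nth atLeast0AtMost lessThan_Suc_atMost del: sum.lessThan_Suc flip: power_mult)
    moreover have "int p dvd fps_nth (T ^ p - (\<Sum>i<Suc n. fps_const (fps_nth A i) * (fps_X ^ p) ^ i)) n"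
      using trunc[of "Suc n"] by (simp add: T_def ring_cong_def fps_of_nat[symmetric] fps_const_dvd_iff)
    ultimately show ?thesis
      by simp
  qed
  then show ?thesis
    unfolding ring_cong_def by (simp add: fps_of_nat[symmetric] fps_const_dvd_iff)
qed

section \<open>Finite and infinite Euler products\<close>

definition qpoch :: "'a::comm_ring_1 \<Rightarrow> nat \<Rightarrow> 'a" where
  "qpoch q n = (\<Prod>i<n. 1 - q ^ Suc i)"

text \<open>Every factor of index at least \<open>k\<close> is 1 modulo
  \<open>fps_X ^ Suc k\<close>, so the truncations agree from \<open>k\<close> on and share these
  coefficients with their limit.\<close>

lemma f_prod_cong:
  assumes "m > 0" "k \<le> n"
  shows "ring_cong (fps_X ^ Suc k) (f_prod m) (qpoch (fps_X ^ m) n)"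
proof -
  have step: "ring_cong (fps_X ^ Suc k) (qpoch (fps_X ^ m) N) (qpoch (fps_X ^ m) k)" if "N \<ge> k" for N
    using that
  proof (induction N rule: dec_induct)
    case (step N)
    have "Suc k \<le> 1 * Suc N"
      using step by simp
    also have "\<dots> \<le> m * Suc N"
      using assms by (intro mult_right_mono) auto
    finally have "fps_X ^ Suc k dvd (fps_X ^ m) ^ Suc N"
      unfolding power_mult[symmetric] by (rule le_imp_power_dvd)
    then have "ring_cong (fps_X ^ Suc k) (1 - (fps_X ^ m) ^ Suc N) 1"
      by (simp add: ring_cong_def)
    then have "ring_cong (fps_X ^ Suc k) (qpoch (fps_X ^ m) N * (1 - (fps_X ^ m) ^ Suc N)) (qpoch (fps_X ^ m) N * 1)"
      by (intro ring_cong_mult) auto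
    also have "qpoch (fps_X ^ m) N * (1 - (fps_X ^ m) ^ Suc N) = qpoch (fps_X ^ m) (Suc N)"
      by (simp add: qpoch_def)
    finally show ?case
      using step.IH by (auto intro: ring_cong_trans)
  qed simp
  have "(\<lambda>N. \<Prod>i<N. 1 - fps_X ^ (m * Suc i)) \<longlonglongrightarrow> f_prod m"
    using has_prod_imp_tendsto'[OF f_prod_has_prod(1)[OF assms(1)]] .
  then have "(\<lambda>N. qpoch (fps_X ^ m) N) \<longlonglongrightarrow> f_prod m"
    by (simp only: qpoch_def power_mult)
  then have "eventually (\<lambda>N. fps_nth (qpoch (fps_X ^ m) N) i = fps_nth (f_prod m) i) sequentially" for i
    by (simp only: tendsto_fps_iff)
  then have ex: "\<exists>N\<ge>k. fps_nth (qpoch (fps_X ^ m) N) i = fps_nth (f_prod m) i" for i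
    unfolding eventually_sequentially by (meson max.cobounded1 max.cobounded2)
  have "ring_cong (fps_X ^ Suc k) (f_prod m) (qpoch (fps_X ^ m) k)"
    unfolding ring_cong_fps_X_power_iff
  proof (intro allI impI)
    fix i assume "i < Suc k"
    with ex[of i] step show "fps_nth (f_prod m) i = fps_nth (qpoch (fps_X ^ m) k) i"
      unfolding ring_cong_fps_X_power_iff by metis
  qed
  then show ?thesis
    using step[OF assms(2)] ring_cong_sym ring_cong_trans by metis
qed

lemma fps_compose_X_power_distrib:
  assumes "m > 0"
  shows "(A * B) oo fps_X ^ m = (A oo fps_X ^ m) * (B oo fps_X ^ m :: 'a::idom fps)"
    and "(A ^ n) oo fps_X ^ m = (A oo fps_X ^ m) ^ n"
  using assms by (auto simp: fps_compose_mult_distrib fps_compose_power)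

lemma fps_compose_X_power_compose:
  assumes "m > 0" "n > 0"
  shows "(A oo fps_X ^ m) oo fps_X ^ n = (A :: 'a::comm_ring_1 fps) oo fps_X ^ (m * n)"
proof (rule fps_ext)
  fix k
  have "m dvd k div n \<longleftrightarrow> m * n dvd k" if "n dvd k"
    using that assms by (metis dvd_div_iff_mult less_not_refl)
  moreover have "n dvd k" if "m * n dvd k"
    using that dvd_mult_right by blast
  ultimately show "fps_nth ((A oo fps_X ^ m) oo fps_X ^ n) k = fps_nth (A oo fps_X ^ (m * n)) k"
    using assms by (auto simp: fps_compose_X_power_nth div_mult2_eq mult.commute)
qed

text \<open>Substitution commutes with finite products, and coefficients below \<open>n\<close>
  after substitution only involve coefficients of \<open>f_prod 1\<close> below \<open>n\<close>, so
  comparing truncations is enough.\<close>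

lemma f_prod_eq_compose:
  assumes "m > 0"
  shows "f_prod m = f_prod 1 oo fps_X ^ m"
proof (rule fps_eq_if_ring_cong)
  fix n
  have "ring_cong (fps_X ^ n) (f_prod 1) (qpoch fps_X n)"
    using f_prod_cong[of 1 n n] by (auto intro: ring_cong_mono[rotated] simp: le_imp_power_dvd)
  then have "fps_nth (f_prod 1 oo fps_X ^ m) i = fps_nth (qpoch fps_X n oo fps_X ^ m) i" if "i < n" for i
    using that assms order_le_less_trans[OF div_le_dividend that]
    by (auto simp: ring_cong_fps_X_power_iff fps_compose_X_power_nth)
  then have "ring_cong (fps_X ^ n) (f_prod 1 oo fps_X ^ m) (qpoch fps_X n oo fps_X ^ m)"
    by (simp add: ring_cong_fps_X_power_iff)
  also have "qpoch (fps_X :: int fps) n oo fps_X ^ m = qpoch (fps_X ^ m) n"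
    using assms by (simp add: qpoch_def fps_compose_prod_distrib fps_compose_sub_distrib
        fps_X_power_compose del: power_Suc)
  finally show "ring_cong (fps_X ^ n) (f_prod m) (f_prod 1 oo fps_X ^ m)"
    using ring_cong_mono[OF _ f_prod_cong[OF assms order_refl], of "fps_X ^ n" n]
    by (auto simp: le_imp_power_dvd intro: ring_cong_trans ring_cong_sym)
qed

text \<open>The generating function of the ordinary partition numbers; \<open>1 / f_m\<close> is
  then \<open>p_ser oo fps_X ^ m\<close>.\<close>

definition p_ser :: "int fps" where
  "p_ser = fps_right_inverse (f_prod 1) 1"

lemma f_prod_p_ser:
  assumes "m > 0"
  shows "f_prod m * (p_ser oo fps_X ^ m) = 1"
proof -
  have "f_prod 1 * p_ser = 1"
    unfolding p_ser_def by (rule fps_right_inverse) (simp add: f_prod_has_prod)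
  then have "(f_prod 1 * p_ser) oo fps_X ^ m = 1"
    by simp
  then show ?thesis
    using assms by (simp add: fps_compose_X_power_distrib f_prod_eq_compose[of m])
qed

section \<open>The Jacobi triple product\<close>

text \<open>The \<open>q\<close>-Pascal recursion defines Gaussian binomials over any commutative
  ring, without division.\<close>

fun gbin :: "'a::comm_ring_1 \<Rightarrow> nat \<Rightarrow> nat \<Rightarrow> 'a" where
  "gbin q n 0 = 1"
| "gbin q 0 (Suc k) = 0"
| "gbin q (Suc n) (Suc k) = gbin q n k + q ^ Suc k * gbin q n (Suc k)"

lemma gbin_eq_0: "n < k \<Longrightarrow> gbin q n k = 0"
  by (induction q n k rule: gbin.induct) auto

lemma gbin_qpoch: "gbin q (n + k) k * qpoch q n * qpoch q k = qpoch q (n + k)"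
proof (induction "n + k" arbitrary: n k)
  case 0
  then show ?case
    by (simp add: qpoch_def)
next
  case (Suc N)
  show ?case
  proof (cases k)
    case 0
    then show ?thesis
      by (simp add: qpoch_def)
  next
    case k: (Suc k')
    have 1: "gbin q (n + k') k' * qpoch q n * qpoch q k' = qpoch q (n + k')"
      using Suc(1)[of n k'] Suc(2) k by simp
    show ?thesis
    proof (cases n)
      case 0
      have "gbin q k' k' * qpoch q k' = qpoch q k'"
        using 1 0 by (simp add: qpoch_def)
      then show ?thesis
        using 0 k by (simp add: gbin_eq_0 qpoch_def flip: mult.assoc)
    next
      case n: (Suc n')
      have 2: "gbin q (Suc (n' + k')) (Suc k') * qpoch q n' * qpoch q (Suc k') = qpoch q (Suc (n' + k'))"
        using Suc(1)[of n' "Suc k'"] Suc(2) k n by simp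
      have "gbin q (n + k) k * qpoch q n * qpoch q k =
          gbin q (n + k') k' * qpoch q n * qpoch q k' * (1 - q ^ Suc k')
          + q ^ Suc k' * (1 - q ^ Suc n') * (gbin q (Suc (n' + k')) (Suc k') * qpoch q n' * qpoch q (Suc k'))"
        unfolding k n by (simp add: qpoch_def algebra_simps)
      also have "\<dots> = qpoch q (Suc (n' + k')) * ((1 - q ^ Suc k') + q ^ Suc k' * (1 - q ^ Suc n'))"
        unfolding 1 2 unfolding n by (simp add: algebra_simps)
      also have "(1 - q ^ Suc k') + q ^ Suc k' * (1 - q ^ Suc n') = 1 - q ^ Suc (Suc (n' + k'))"
        by (simp add: algebra_simps power_add)
      also have "qpoch q (Suc (n' + k')) * (1 - q ^ Suc (Suc (n' + k'))) = qpoch q (n + k)"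
        unfolding k n by (simp add: qpoch_def)
      finally show ?thesis .
    qed
  qed
qed

lemma choose_two_rec: "0 choose 2 = 0" "Suc n choose 2 = (n choose 2) + n"
  by (simp_all add: numeral_2_eq_2)

text \<open>Splitting off the factor \<open>i = 0\<close> leaves the shorter product with
  \<open>z * q\<close> in place of \<open>z\<close>. The homogeneous form allows \<open>w\<close> to
  be replaced by \<open>w * q ^ n\<close> later.\<close>

lemma q_binomial_theorem:
  "(\<Prod>i<N. w + z * q ^ i) = (\<Sum>k\<le>N. q ^ (k choose 2) * gbin q N k * z ^ k * w ^ (N - k))"
proof (induction N arbitrary: z)
  case 0
  then show ?case by (simp add: choose_two_rec)
next
  case (Suc N)
  define u where "u = (\<lambda>k. q ^ (k choose 2) * q ^ k * gbin q N k * z ^ k * w ^ (Suc N - k))"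
  define v where "v = (\<lambda>k. q ^ (k choose 2) * q ^ k * gbin q N k * z ^ Suc k * w ^ (N - k))"
  have "(\<Prod>i<Suc N. w + z * q ^ i) = (w + z) * (\<Prod>i<N. w + (z * q) * q ^ i)"
    unfolding prod.lessThan_Suc_shift by (simp add: mult.assoc)
  also have "\<dots> = (w + z) * (\<Sum>k\<le>N. q ^ (k choose 2) * gbin q N k * (z * q) ^ k * w ^ (N - k))"
    by (simp only: Suc)
  also have "\<dots> = (\<Sum>k\<le>N. u k) + (\<Sum>k\<le>N. v k)"
    unfolding u_def v_def distrib_right sum_distrib_left sum.distrib
    by (intro arg_cong2[where f = "(+)"] sum.cong refl)
      (auto simp: Suc_diff_le power_mult_distrib mult_ac)
  also have "(\<Sum>k\<le>N. u k) = (\<Sum>k\<le>Suc N. u k)"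
    by (simp add: u_def gbin_eq_0)
  also have "\<dots> = u 0 + (\<Sum>k\<le>N. u (Suc k))"
    by (rule sum.atMost_Suc_shift)
  finally have "(\<Prod>i<Suc N. w + z * q ^ i) = u 0 + (\<Sum>k\<le>N. u (Suc k) + v k)"
    by (simp add: sum.distrib add.assoc)
  also have "\<dots> = (\<Sum>k\<le>Suc N. q ^ (k choose 2) * gbin q (Suc N) k * z ^ k * w ^ (Suc N - k))"
    unfolding sum.atMost_Suc_shift[of _ N] u_def v_def
    by (intro arg_cong2[where f = "(+)"] sum.cong refl)
      (simp_all add: choose_two_rec power_add algebra_simps)
  finally show ?case .
qed

section \<open>The finite triple product and its limit\<close>

definition tri :: "int \<Rightarrow> nat" where
  "tri j = nat (j * (j - 1) div 2)"

lemma tri_int: "2 * int (tri j) = j * (j - 1)"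
proof -
  have "0 \<le> j * (j - 1)"
    by (cases "j \<ge> 1") (auto simp: mult_nonneg_nonneg mult_nonpos_nonpos)
  moreover have "even (j * (j - 1))"
    by auto
  ultimately show ?thesis
    by (simp add: tri_def)
qed

lemma choose_two_int: "2 * int (n choose 2) = int n * (int n - 1)"
  by (induction n) (auto simp: choose_two_rec algebra_simps)

lemma prod_lessThan_add: "(\<Prod>i<m + n. f i) = (\<Prod>i<m. f i) * (\<Prod>i<n. f (m + i))"
  for f :: "nat \<Rightarrow> 'a::comm_monoid_mult"
  by (induction n) (auto simp: mult.assoc)

lemma prod_power_lessThan: "(\<Prod>i<n. q ^ i) = (q :: 'a::comm_monoid_mult) ^ (n choose 2)"
  by (induction n) (auto simp: choose_two_rec power_add mult_ac)

lemma jacobi_triple_finite: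
  fixes q z w :: "'a::idom"
  assumes "q \<noteq> 0"
  shows "(\<Prod>i<n. (z + w * q ^ Suc i) * (w + z * q ^ i)) =
    (\<Sum>j=-int n..int n. q ^ tri j * gbin q (2 * n) (nat (int n + j)) * z ^ nat (int n + j) * w ^ nat (int n - j))"
proof -
  \<comment> \<open>Multiplying by \<open>q ^ C\<close> clears negative exponents:
    \<open>q ^ (n choose 2)\<close>, distributed in reverse order, turns the factors
    \<open>z + w * q ^ Suc i\<close> into \<open>w * q ^ n + z * q ^ i\<close>, and
    \<open>q ^ (n * n)\<close> shifts the other half to follow them. The \<open>2 * n\<close>
    factors then form one product for the \<open>q\<close>-binomial theorem, recentred by
    \<open>k = n + j\<close>.\<close>
  define C where "C = (n choose 2) + n * n"
  have "q ^ C * (\<Prod>i<n. (z + w * q ^ Suc i) * (w + z * q ^ i)) =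
      ((\<Prod>i<n. q ^ i) * (\<Prod>i<n. z + w * q ^ Suc i)) * ((\<Prod>i<n. q ^ n) * (\<Prod>i<n. w + z * q ^ i))"
    by (simp add: C_def power_add prod_power_lessThan prod.distrib power_mult mult_ac)
  also have "(\<Prod>i<n. q ^ i) * (\<Prod>i<n. z + w * q ^ Suc i) = (\<Prod>i<n. q ^ (n - Suc i) * (z + w * q ^ Suc i))"
    unfolding prod.distrib by (subst prod.nat_diff_reindex) simp
  also have "\<dots> = (\<Prod>i<n. w * q ^ n + z * q ^ (n - Suc i))"
    by (intro prod.cong refl) (auto simp: algebra_simps simp flip: power_add power_Suc)
  also have "\<dots> = (\<Prod>i<n. w * q ^ n + z * q ^ i)"
    by (rule prod.nat_diff_reindex)
  also have "(\<Prod>i<n. q ^ n) * (\<Prod>i<n. w + z * q ^ i) = (\<Prod>i<n. w * q ^ n + z * q ^ (n + i))"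
    unfolding prod.distrib[symmetric] by (simp add: algebra_simps power_add)
  also have "(\<Prod>i<n. w * q ^ n + z * q ^ i) * (\<Prod>i<n. w * q ^ n + z * q ^ (n + i))
      = (\<Prod>i<2 * n. w * q ^ n + z * q ^ i)"
    unfolding mult_2 prod_lessThan_add ..
  also have "\<dots> = (\<Sum>k\<le>2 * n. q ^ (k choose 2) * gbin q (2 * n) k * z ^ k * (w * q ^ n) ^ (2 * n - k))"
    by (rule q_binomial_theorem)
  also have "\<dots> = (\<Sum>j=-int n..int n. q ^ C * (q ^ tri j * gbin q (2 * n) (nat (int n + j)) * z ^ nat (int n + j) * w ^ nat (int n - j)))"
  proof (rule sum.reindex_bij_witness[of _ "\<lambda>j. nat (int n + j)" "\<lambda>k. int k - int n"])
    fix k assume k: "k \<in> {..2 * n}"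
    have "2 * (int (k choose 2) + int n * int (2 * n - k)) = 2 * (int C + int (tri (int k - int n)))"
      using k choose_two_int[of n] choose_two_int[of k] tri_int[of "int k - int n"]
      by (simp add: C_def algebra_simps)
    then have "int ((k choose 2) + n * (2 * n - k)) = int (C + tri (int k - int n))"
      by simp
    then have "(k choose 2) + n * (2 * n - k) = C + tri (int k - int n)"
      by (simp only: of_nat_eq_iff)
    then have "q ^ (k choose 2) * q ^ (n * (2 * n - k)) = q ^ C * q ^ tri (int k - int n)"
      by (simp flip: power_add)
    moreover have "nat (int n - (int k - int n)) = 2 * n - k"
      using k by auto
    ultimately show "q ^ C * (q ^ tri (int k - int n) * gbin q (2 * n) (nat (int n + (int k - int n))) *
        z ^ nat (int n + (int k - int n)) * w ^ nat (int n - (int k - int n))) =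
        q ^ (k choose 2) * gbin q (2 * n) k * z ^ k * (w * q ^ n) ^ (2 * n - k)"
      by (simp add: power_mult_distrib power_mult[symmetric] mult_ac)
  qed auto
  also have "\<dots> = q ^ C * (\<Sum>j=-int n..int n. q ^ tri j * gbin q (2 * n) (nat (int n + j)) * z ^ nat (int n + j) * w ^ nat (int n - j))"
    by (simp add: sum_distrib_left)
  finally show ?thesis
    using assms by simp
qed

text \<open>Only meaningful if all the fibres of \<open>e\<close> are finite: otherwise the sum is the junk value \<open>0\<close>.\<close>
definition theta :: "(int \<Rightarrow> nat) \<Rightarrow> (int \<Rightarrow> int) \<Rightarrow> int fps" where
  "theta e c = Abs_fps (\<lambda>N. \<Sum>j\<in>{j. e j = N}. c j)"

text \<open>The growth bound makes the fibres of \<open>e\<close> finite and places every exponent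
  below \<open>n\<close> at an index with \<open>|j| \<le> n\<close>. The slack 1 is forced by
  \<open>tri 1 = 0\<close>.\<close>

lemma theta_cong_sum:
  assumes "\<And>j. \<bar>j\<bar> \<le> int (e j) + 1"
  shows "ring_cong (fps_X ^ n) (theta e c) (\<Sum>j=-int n..int n. fps_const (c j) * fps_X ^ e j)"
  unfolding ring_cong_fps_X_power_iff
proof (intro allI impI)
  fix i assume "i < n"
  have "{j. e j = i} = {j\<in>{-int n..int n}. e j = i}"
  proof -
    have "j \<in> {-int n..int n}" if "e j = i" for j
      using assms[of j] that \<open>i < n\<close> by auto
    then show ?thesis
      by blast
  qed
  then show "fps_nth (theta e c) i = fps_nth (\<Sum>j=-int n..int n. fps_const (c j) * fps_X ^ e j) i"
    by (auto simp: theta_def fps_sum_nth sum.If_cases if_distrib[of "(*) _"] cong: if_cong intro!: sum.cong)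
qed

text \<open>By \<open>gbin_qpoch\<close> the Gaussian binomial is a quotient of three finite
  products of lengths \<open>2n\<close>, \<open>n - j\<close> and \<open>n + j\<close>. Each equals
  \<open>f_m\<close> up to order \<open>n - |j|\<close>, so the quotient is \<open>1 / f_m\<close>
  to that accuracy.\<close>

lemma gbin_mult_f_prod_cong:
  assumes "m > 0" "\<bar>j\<bar> \<le> int n"
  shows "ring_cong (fps_X ^ Suc (n - nat \<bar>j\<bar>)) (gbin (fps_X ^ m) (2 * n) (nat (int n + j)) * f_prod m) 1"
proof -
  define d :: "int fps" where "d = fps_X ^ Suc (n - nat \<bar>j\<bar>)"
  define F where "F = f_prod m"
  define g where "g = gbin (fps_X ^ m :: int fps) (2 * n) (nat (int n + j))"
  define P :: "int fps" where "P = p_ser oo fps_X ^ m"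
  have F: "ring_cong d F (qpoch (fps_X ^ m) k)" if "n - nat \<bar>j\<bar> \<le> k" for k
    using f_prod_cong[OF assms(1) that] by (simp add: d_def F_def)
  have split: "nat (int n - j) + nat (int n + j) = 2 * n"
    using assms by auto
  have "ring_cong d (g * F * F) (g * qpoch (fps_X ^ m) (nat (int n - j)) * qpoch (fps_X ^ m) (nat (int n + j)))"
    by (intro ring_cong_mult ring_cong_refl F) auto
  also have "\<dots> = qpoch (fps_X ^ m) (2 * n)"
    using gbin_qpoch[of "fps_X ^ m :: int fps" "nat (int n - j)" "nat (int n + j)"] unfolding split by (simp add: g_def)
  also have "ring_cong d \<dots> F"
    by (rule ring_cong_sym, rule F) auto
  finally have "ring_cong d (g * F * F * P) (F * P)"
    by (rule ring_cong_mult) simp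
  moreover have "F * P = 1"
    using f_prod_p_ser[OF assms(1)] by (simp add: F_def P_def)
  ultimately show ?thesis
    by (simp add: d_def g_def F_def mult.assoc)
qed

text \<open>The passage from finite to infinite identities, common to the three specialisations
  below; \<open>L\<close> is the limit of the product side.\<close>

lemma jacobi_triple_limit:
  assumes m: "m > 0" and e: "\<And>j. \<bar>j\<bar> \<le> int (e j) + 1"
    and L: "\<And>n. ring_cong (fps_X ^ n)
      (\<Sum>j=-int n..int n. fps_const (c j) * fps_X ^ e j * gbin (fps_X ^ m) (2 * n) (nat (int n + j))) L"
  shows "L * f_prod m = theta e c"
proof (rule fps_eq_if_ring_cong)
  fix n
  let ?S = "\<Sum>j=-int n..int n. fps_const (c j) * fps_X ^ e j * gbin (fps_X ^ m) (2 * n) (nat (int n + j))"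
  have "ring_cong (fps_X ^ n) (L * f_prod m) (?S * f_prod m)"
    using L by (intro ring_cong_mult ring_cong_sym[of _ ?S]) auto
  also have "?S * f_prod m = (\<Sum>j=-int n..int n. fps_const (c j) * (fps_X ^ e j * (gbin (fps_X ^ m) (2 * n) (nat (int n + j)) * f_prod m)))"
    by (simp add: sum_distrib_right mult.assoc)
  also have "ring_cong (fps_X ^ n) \<dots> (\<Sum>j=-int n..int n. fps_const (c j) * fps_X ^ e j)"
  proof (intro ring_cong_sum)
    fix j assume "j \<in> {-int n..int n}"
    then have j: "\<bar>j\<bar> \<le> int n"
      by auto
    let ?G = "gbin (fps_X ^ m) (2 * n) (nat (int n + j)) * f_prod m"
    \<comment> \<open>The accuracy \<open>|j|\<close> lost in the Gaussian binomial is regained from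
      the factor \<open>fps_X ^ e j\<close>.\<close>
    have "n \<le> e j + Suc (n - nat \<bar>j\<bar>)"
      using e[of j] j by linarith
    then have "fps_X ^ n dvd (fps_X ^ (e j + Suc (n - nat \<bar>j\<bar>)) :: int fps)"
      by (rule le_imp_power_dvd)
    also have "\<dots> dvd fps_X ^ e j * (?G - 1)"
      using gbin_mult_f_prod_cong[OF m j] unfolding ring_cong_def power_add by (rule mult_dvd_mono[OF dvd_refl])
    also have "\<dots> dvd fps_const (c j) * (fps_X ^ e j * (?G - 1))"
      by simp
    finally show "ring_cong (fps_X ^ n) (fps_const (c j) * (fps_X ^ e j * ?G)) (fps_const (c j) * fps_X ^ e j)"
      by (simp add: ring_cong_def algebra_simps)
  qed
  also have "ring_cong (fps_X ^ n) \<dots> (theta e c)"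
    using theta_cong_sum[OF e] by (rule ring_cong_sym)
  finally show "ring_cong (fps_X ^ n) (L * f_prod m) (theta e c)" .
qed

section \<open>Theta series for \<open>f_2^2 / f_1\<close>, \<open>f_1\<close> and
  \<open>f_1^3\<close>\<close>

definition alt :: "int \<Rightarrow> int" where
  "alt j = (if even j then 1 else -1)"

lemma alt_nat: "(-1) ^ nat (int n + j) = ((-1) ^ n * of_int (alt j) :: 'a::comm_ring_1)" if "\<bar>j\<bar> \<le> int n"
proof -
  have "even (nat (int n + j)) \<longleftrightarrow> even (int n + j)"
    using that by (auto simp: even_nat_iff)
  then show ?thesis
    by (simp add: minus_one_power_iff alt_def)
qed

lemma f_prod_cong': "m > 0 \<Longrightarrow> n \<le> Suc k \<Longrightarrow> ring_cong (fps_X ^ n) (qpoch (fps_X ^ m) k) (f_prod m)"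
  using f_prod_cong[of m k k] by (meson order_refl le_imp_power_dvd ring_cong_mono ring_cong_sym)

lemma abs_le_tri: "\<bar>j\<bar> \<le> int (tri j) + 1"
proof -
  have "2 * \<bar>j\<bar> \<le> j * (j - 1) + 2"
  proof (cases "j \<ge> 0")
    case True
    have "0 \<le> (j - 1) * (j - 2)"
      by (cases "j \<le> 1") (auto simp: mult_nonneg_nonneg mult_nonpos_nonpos)
    then show ?thesis
      using True by (simp add: algebra_simps)
  next
    case False
    have "0 \<le> (j + 1) * j"
      using False by (intro mult_nonpos_nonpos) auto
    then show ?thesis
      using False by (simp add: algebra_simps)
  qed
  then show ?thesis
    using tri_int[of j] by linarith
qed

lemma qpoch_mult_plus: "(\<Prod>i<n. 1 + q ^ Suc i) * qpoch q n = qpoch (q ^ 2) n"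
  unfolding qpoch_def prod.distrib[symmetric]
  by (intro prod.cong refl) (simp add: algebra_simps power2_eq_square power_mult_distrib)

text \<open>Gauss's identity, from \<open>z = w = 1\<close>. The factor 2 appears because
  \<open>j\<close> and \<open>1 - j\<close> give the same triangular number.\<close>

lemma theta_triangular: "theta tri (\<lambda>_. 1) = 2 * f_prod 2 ^ 2 * p_ser"
proof -
  have P: "f_prod 1 * p_ser = 1"
    using f_prod_p_ser[of 1] by simp
  have "theta tri (\<lambda>_. 1) = 2 * f_prod 2 ^ 2 * p_ser ^ 2 * f_prod 1"
  proof (rule jacobi_triple_limit[symmetric])
    fix n
    let ?S = "\<Sum>j=-int n..int n. fps_const 1 * fps_X ^ tri j * gbin (fps_X ^ 1) (2 * n) (nat (int n + j)) :: int fps"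
    show "ring_cong (fps_X ^ n) ?S (2 * f_prod 2 ^ 2 * p_ser ^ 2)"
    proof (cases n)
      case (Suc m)
      have "?S = (\<Prod>i<n. (1 + fps_X ^ Suc i) * (1 + fps_X ^ i))"
        using jacobi_triple_finite[of "fps_X :: int fps" 1 1 n] by simp
      \<comment> \<open>The second product begins with \<open>1 + fps_X ^ 0 = 2\<close>, which
        leaves one factor fewer there.\<close>
      also have "\<dots> = 2 * (\<Prod>i<n. 1 + fps_X ^ Suc i) * (\<Prod>i<m. 1 + fps_X ^ Suc i)"
        unfolding prod.distrib unfolding Suc prod.lessThan_Suc_shift[of _ m] by simp
      finally have "?S * qpoch fps_X n * qpoch fps_X m =
          2 * ((\<Prod>i<n. 1 + fps_X ^ Suc i) * qpoch fps_X n) * ((\<Prod>i<m. 1 + fps_X ^ Suc i) * qpoch fps_X m)"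
        by (simp only: mult_ac)
      also have "\<dots> = 2 * qpoch (fps_X ^ 2) n * qpoch (fps_X ^ 2) m"
        by (simp only: qpoch_mult_plus)
      also have "ring_cong (fps_X ^ n) \<dots> (2 * f_prod 2 * f_prod 2)"
        using Suc by (intro ring_cong_mult ring_cong_refl f_prod_cong') auto
      finally have 1: "ring_cong (fps_X ^ n) (?S * qpoch fps_X n * qpoch fps_X m) (2 * f_prod 2 * f_prod 2)" .
      have "ring_cong (fps_X ^ n) (?S * f_prod 1 * f_prod 1) (?S * qpoch fps_X n * qpoch fps_X m)"
        using f_prod_cong'[of 1 n n] f_prod_cong'[of 1 n m] Suc
        by (intro ring_cong_mult ring_cong_refl) (auto intro: ring_cong_sym)
      from ring_cong_mult[OF ring_cong_trans[OF this 1], of "p_ser * p_ser" "p_ser * p_ser"]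
      have "ring_cong (fps_X ^ n) (?S * (f_prod 1 * p_ser) * (f_prod 1 * p_ser)) (2 * f_prod 2 ^ 2 * p_ser ^ 2)"
        by (simp only: ring_cong_refl simp_thms power2_eq_square mult_ac)
      then show ?thesis
        by (simp only: P mult_1_right)
    qed (simp add: ring_cong_def)
  qed (use abs_le_tri in auto)
  also have "2 * f_prod 2 ^ 2 * p_ser ^ 2 * f_prod 1 = 2 * f_prod 2 ^ 2 * p_ser * (f_prod 1 * p_ser)"
    by (simp add: power2_eq_square mult_ac)
  finally show ?thesis
    using P by simp
qed

definition pent :: "int \<Rightarrow> nat" where
  "pent j = nat (j * (3 * j - 1) div 2)"

lemma pent_int: "2 * int (pent j) = j * (3 * j - 1)"
proof -
  have "0 \<le> j * (3 * j - 1)"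
    by (cases "j \<ge> 1") (auto simp: mult_nonneg_nonneg mult_nonpos_nonpos)
  moreover have "even (j * (3 * j - 1))"
    by auto
  ultimately show ?thesis
    by (simp add: pent_def)
qed

lemma abs_le_pent: "\<bar>j\<bar> \<le> int (pent j) + 1"
proof -
  have "0 \<le> (3 * j + 1) * j"
    by (cases "j \<ge> 0") (auto simp: mult_nonneg_nonneg mult_nonpos_nonpos)
  moreover have "0 \<le> (j - 1) * j"
    by (cases "j \<ge> 1") (auto simp: mult_nonneg_nonneg mult_nonpos_nonpos)
  moreover have "2 * int (pent j) = 3 * (j * j) - j"
    using pent_int[of j] by (simp add: algebra_simps)
  ultimately show ?thesis
    by (simp add: algebra_simps)
qed

lemma qpoch_cube_split:
  "(\<Prod>i<n. (1 - q ^ (3 * i + 2)) * (1 - q ^ (3 * i + 1))) * qpoch (q ^ 3) n = qpoch q (3 * n)"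
proof (induction n)
  case 0
  then show ?case by (simp add: qpoch_def)
next
  case (Suc n)
  have "qpoch q (3 * Suc n) = qpoch q (3 * n) * ((1 - q ^ (3 * n + 1)) * (1 - q ^ (3 * n + 2)) * (1 - q ^ (3 * n + 3)))"
    by (simp add: qpoch_def numeral_3_eq_3 mult_ac)
  moreover have "qpoch (q ^ 3) (Suc n) = qpoch (q ^ 3) n * (1 - q ^ (3 * n + 3))"
    by (simp add: qpoch_def power_add power_mult flip: power_Suc2)
  ultimately show ?case
    unfolding Suc[symmetric] by (simp only: prod.lessThan_Suc mult_ac)
qed

text \<open>Euler's pentagonal number theorem: the triple product with base
  \<open>fps_X ^ 3\<close>, \<open>z = - fps_X\<close> and \<open>w = 1\<close>. Its factors cover
  the residues 1 and 2 modulo 3, and \<open>f_3\<close> supplies the rest.\<close>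

lemma theta_pentagonal: "theta pent alt = f_prod 1"
proof -
  define P :: "int fps" where "P = p_ser oo fps_X ^ 3"
  have P: "f_prod 3 * P = 1"
    using f_prod_p_ser[of 3] by (simp add: P_def)
  have "f_prod 1 * P * f_prod 3 = theta pent alt"
  proof (rule jacobi_triple_limit)
    fix n
    let ?S = "\<Sum>j=-int n..int n. fps_const (alt j) * fps_X ^ pent j * gbin (fps_X ^ 3) (2 * n) (nat (int n + j)) :: int fps"
    \<comment> \<open>Each factor \<open>z + w * q ^ Suc i\<close> is divisible by
      \<open>- fps_X\<close>; the collected power \<open>(- fps_X) ^ n\<close> cancels against the
      shift of the summation index at the end.\<close>
    have "(- fps_X) ^ n * (\<Prod>i<n. (1 - fps_X ^ (3 * i + 2)) * (1 - fps_X ^ (3 * i + 1)))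
        = (\<Prod>i<n. (- fps_X + 1 * (fps_X ^ 3) ^ Suc i) * (1 + (- fps_X) * (fps_X ^ 3) ^ i) :: int fps)"
    proof -
      have "(- fps_X + 1 * (fps_X ^ 3) ^ Suc i) * (1 + (- fps_X) * (fps_X ^ 3) ^ i)
          = - fps_X * ((1 - fps_X ^ (3 * i + 2)) * (1 - fps_X ^ (3 * i + 1)) :: int fps)" for i
      proof -
        have "(fps_X ^ 3) ^ Suc i = fps_X * (fps_X ^ (3 * i + 2) :: int fps)"
          "(- fps_X) * (fps_X ^ 3) ^ i = - (fps_X ^ (3 * i + 1) :: int fps)"
          by (simp_all add: power_mult[symmetric] flip: power_Suc)
        moreover have "(- x + x * a) * (1 - b) = - x * ((1 - a) * (1 - b))" for x a b :: "int fps"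
          by (simp add: algebra_simps)
        ultimately show ?thesis
          by (simp only: mult_1_left add_uminus_conv_diff)
      qed
      then show ?thesis
        by (simp only: prod.distrib prod_constant card_lessThan)
    qed
    also have "\<dots> = (\<Sum>j=-int n..int n. (fps_X ^ 3) ^ tri j * gbin (fps_X ^ 3) (2 * n) (nat (int n + j)) * (- fps_X) ^ nat (int n + j) * 1 ^ nat (int n - j))"
      by (rule jacobi_triple_finite) auto
    also have "\<dots> = (\<Sum>j=-int n..int n. (- fps_X) ^ n * (fps_const (alt j) * fps_X ^ pent j * gbin (fps_X ^ 3) (2 * n) (nat (int n + j))))"
    proof (intro sum.cong refl)
      fix j assume "j \<in> {-int n..int n}"
      then have j: "\<bar>j\<bar> \<le> int n"
        by auto
      have "2 * int (3 * tri j + nat (int n + j)) = 2 * int (n + pent j)"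
        using tri_int[of j] pent_int[of j] j by (simp add: algebra_simps)
      then have "3 * tri j + nat (int n + j) = n + pent j"
        unfolding mult_cancel_left of_nat_eq_iff by simp
      then have X: "fps_X ^ (3 * tri j) * fps_X ^ nat (int n + j) = (fps_X ^ n * fps_X ^ pent j :: int fps)"
        by (simp flip: power_add)
      have "(- fps_X :: int fps) ^ nat (int n + j) = (-1) ^ nat (int n + j) * fps_X ^ nat (int n + j)"
        by (rule power_minus)
      also have "(-1 :: int fps) ^ nat (int n + j) = (-1) ^ n * fps_const (alt j)"
        by (simp add: alt_nat[OF j] flip: fps_of_int)
      finally have "(fps_X ^ 3) ^ tri j * (- fps_X :: int fps) ^ nat (int n + j)
          = (-1) ^ n * fps_const (alt j) * (fps_X ^ (3 * tri j) * fps_X ^ nat (int n + j))"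
        by (simp add: power_mult[symmetric] mult_ac)
      also have "\<dots> = (- fps_X) ^ n * (fps_const (alt j) * fps_X ^ pent j)"
        unfolding X power_minus[of fps_X n] by (simp only: mult_ac)
      finally have k: "(fps_X ^ 3) ^ tri j * (- fps_X :: int fps) ^ nat (int n + j)
          = (- fps_X) ^ n * (fps_const (alt j) * fps_X ^ pent j)" .
      have "(fps_X ^ 3) ^ tri j * gbin (fps_X ^ 3) (2 * n) (nat (int n + j)) * (- fps_X) ^ nat (int n + j) * 1 ^ nat (int n - j)
          = ((fps_X ^ 3) ^ tri j * (- fps_X :: int fps) ^ nat (int n + j)) * gbin (fps_X ^ 3) (2 * n) (nat (int n + j))"
        by simp
      then show "(fps_X ^ 3) ^ tri j * gbin (fps_X ^ 3) (2 * n) (nat (int n + j)) * (- fps_X) ^ nat (int n + j) * 1 ^ nat (int n - j)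
          = (- fps_X :: int fps) ^ n * (fps_const (alt j) * fps_X ^ pent j * gbin (fps_X ^ 3) (2 * n) (nat (int n + j)))"
        by (simp only: k mult.assoc)
    qed
    also have "\<dots> = (- fps_X) ^ n * ?S"
      by (rule sum_distrib_left[symmetric])
    finally have "?S = (\<Prod>i<n. (1 - fps_X ^ (3 * i + 2)) * (1 - fps_X ^ (3 * i + 1)))"
      by simp
    then have 1: "?S * qpoch (fps_X ^ 3) n = qpoch (fps_X ^ 1) (3 * n)"
      by (simp only: qpoch_cube_split power_one_right)
    have "ring_cong (fps_X ^ n) (?S * f_prod 3) (?S * qpoch (fps_X ^ 3) n)"
      by (intro ring_cong_mult ring_cong_refl ring_cong_sym[OF f_prod_cong']) auto
    also have "ring_cong (fps_X ^ n) (?S * qpoch (fps_X ^ 3) n) (f_prod 1)"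
      unfolding 1 by (rule f_prod_cong') auto
    finally have "ring_cong (fps_X ^ n) (?S * f_prod 3 * P) (f_prod 1 * P)"
      by (rule ring_cong_mult) simp
    then show "ring_cong (fps_X ^ n) ?S (f_prod 1 * P)"
      using P by (simp add: mult.assoc)
  qed (use abs_le_pent in auto)
  then show ?thesis
    using P by (simp only: mult.assoc mult.commute[of P] mult_1_right)
qed

lemma pderiv_sum: "pderiv (\<Sum>i\<in>S. f i) = (\<Sum>i\<in>S. pderiv (f i :: 'a::idom poly))"
  by (induction S rule: infinite_finite_induct) (auto simp: pderiv_add)

lemma gbin_const_poly: "gbin [:q:] n k = [:gbin q n k:]"
  by (induction q n k rule: gbin.induct) (auto simp: one_pCons poly_const_pow)

text \<open>
  Differentiating the finite triple product in \<open>z\<close> at its zero \<open>z = -1\<close> leaves the product of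
  the remaining factors.
\<close>
lemma jacobi_cube_finite:
  fixes q :: "'a::idom"
  assumes "q \<noteq> 0"
  shows "(\<Sum>j=-int (Suc m)..int (Suc m). of_int (alt j * j) * q ^ tri j * gbin q (2 * Suc m) (nat (int (Suc m) + j)))
      = - (qpoch q (Suc m) * qpoch q m)"
proof -
  define n where "n = Suc m"
  \<comment> \<open>The triple product is taken over the polynomial ring, with \<open>z\<close> the
    indeterminate and \<open>q\<close> constant; \<open>H\<close> omits the factor
    \<open>1 + z\<close>, so it equals the derivative of the whole product at
    \<open>z = -1\<close>.\<close>
  let ?z = "[:0, 1:] :: 'a poly"
  define H where "H = (\<Prod>i<n. ?z + 1 * [:q:] ^ Suc i) * (\<Prod>i<m. 1 + ?z * [:q:] ^ Suc i)"
  define a where "a = (\<lambda>j. q ^ tri j * gbin q (2 * n) (nat (int n + j)))"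
  have "(\<Prod>i<n. (?z + 1 * [:q:] ^ Suc i) * (1 + ?z * [:q:] ^ i)) = (1 + ?z) * H"
    unfolding prod.distrib H_def unfolding n_def prod.lessThan_Suc_shift[of _ m] by (simp only: power_0 mult_ac mult_1_right mult_1)
  moreover have "(\<Prod>i<n. (?z + 1 * [:q:] ^ Suc i) * (1 + ?z * [:q:] ^ i)) =
      (\<Sum>j=-int n..int n. [:q:] ^ tri j * gbin [:q:] (2 * n) (nat (int n + j)) * ?z ^ nat (int n + j) * 1 ^ nat (int n - j))"
    by (rule jacobi_triple_finite) (use assms in auto)
  ultimately have eq: "(1 + ?z) * H = (\<Sum>j=-int n..int n. smult (a j) (?z ^ nat (int n + j)))"
    by (simp add: a_def gbin_const_poly poly_const_pow mult.commute)
  have "poly ((1 + ?z) * H) (-1) = (\<Sum>j=-int n..int n. a j * (-1) ^ nat (int n + j))"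
    unfolding eq by (simp add: poly_sum)
  then have val: "(\<Sum>j=-int n..int n. a j * (-1) ^ nat (int n + j)) = 0"
    by simp
  have "poly H (-1) = poly (pderiv ((1 + ?z) * H)) (-1)"
    by (simp add: pderiv_mult pderiv_add pderiv_pCons)
  also have "\<dots> = (\<Sum>j=-int n..int n. a j * (of_nat (nat (int n + j)) * (-1) ^ (nat (int n + j) - 1)))"
    unfolding eq by (simp add: pderiv_sum poly_sum pderiv_smult pderiv_power pderiv_pCons mult.assoc)
  \<comment> \<open>Differentiation produces the weight \<open>n + j\<close>; the part with weight
    \<open>n\<close> is a multiple of the vanishing sum \<open>val\<close>.\<close>
  also have "\<dots> = (\<Sum>j=-int n..int n. - of_nat n * (a j * (-1) ^ nat (int n + j)) - ((-1) ^ n) * (of_int (alt j * j) * a j))"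
  proof (intro sum.cong refl)
    fix j assume "j \<in> {-int n..int n}"
    then have j: "\<bar>j\<bar> \<le> int n"
      by auto
    have "of_nat k * (-1) ^ (k - 1) = - (of_nat k * (-1) ^ k :: 'a)" for k
      by (cases k) auto
    then have e: "of_nat (nat (int n + j)) * (-1) ^ (nat (int n + j) - 1) = - (of_nat (nat (int n + j)) * (-1) ^ nat (int n + j) :: 'a)" .
    have n: "(of_nat (nat (int n + j)) :: 'a) = of_int (int n + j)"
      using j by simp
    have k: "of_nat (nat (int n + j)) * (-1) ^ (nat (int n + j) - 1) = - (of_int (int n + j) * ((-1) ^ n * of_int (alt j)) :: 'a)"
      unfolding e unfolding n alt_nat[OF j] ..
    show "a j * (of_nat (nat (int n + j)) * (-1) ^ (nat (int n + j) - 1)) =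
        - of_nat n * (a j * (-1) ^ nat (int n + j)) - ((-1) ^ n) * (of_int (alt j * j) * a j)"
      unfolding k alt_nat[OF j] by (simp add: algebra_simps)
  qed
  also have "\<dots> = - ((-1) ^ n) * (\<Sum>j=-int n..int n. of_int (alt j * j) * a j)"
    unfolding sum_subtractf sum_distrib_left[symmetric] val by simp
  finally have "(\<Sum>j=-int n..int n. of_int (alt j * j) * a j) = - ((-1) ^ n) * poly H (-1)"
    by (simp flip: mult.assoc power_add)
  also have "poly H (-1) = (\<Prod>i<n. - (1 - q ^ Suc i)) * qpoch q m"
    by (simp add: H_def qpoch_def poly_prod poly_const_pow del: power_Suc)
  also have "(\<Prod>i<n. - (1 - q ^ Suc i)) = (-1) ^ n * qpoch q n"
    unfolding qpoch_def prod_uminus by simp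
  finally show ?thesis
    by (simp add: n_def a_def mult.assoc flip: power_mult_distrib)
qed

text \<open>Jacobi's identity in bilateral form: the terms at \<open>j\<close> and
  \<open>1 - j\<close> share an exponent and add up to the classical coefficient
  \<open>alt j * (2 * j - 1)\<close>.\<close>

lemma theta_cube: "theta tri (\<lambda>j. alt j * j) = - (f_prod 1 ^ 3)"
proof -
  have "- (f_prod 1 ^ 2) * f_prod 1 = theta tri (\<lambda>j. alt j * j)"
  proof (rule jacobi_triple_limit)
    fix n
    let ?S = "\<lambda>n. \<Sum>j=-int n..int n. fps_const (alt j * j) * fps_X ^ tri j * gbin (fps_X ^ 1) (2 * n) (nat (int n + j)) :: int fps"
    show "ring_cong (fps_X ^ n) (?S n) (- (f_prod 1 ^ 2))"
    proof (cases n)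
      case (Suc m)
      have "?S n = - (qpoch (fps_X ^ 1) n * qpoch (fps_X ^ 1) m)"
        using jacobi_cube_finite[of "fps_X :: int fps" m] unfolding Suc fps_of_int[symmetric] by simp
      also have "\<dots> = 0 - qpoch (fps_X ^ 1) n * qpoch (fps_X ^ 1) m"
        by simp
      also have "ring_cong (fps_X ^ n) (0 - qpoch (fps_X ^ 1) n * qpoch (fps_X ^ 1) m) (0 - f_prod 1 * f_prod 1)"
        using Suc by (intro ring_cong_diff ring_cong_mult ring_cong_refl f_prod_cong') auto
      finally show ?thesis
        by (simp add: power2_eq_square)
    qed (simp add: ring_cong_def)
  qed (use abs_le_tri in auto)
  then show ?thesis
    by (simp add: power2_eq_square power3_eq_cube)
qed

section \<open>Ramanujan's congruence modulo 11\<close>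

text \<open>Exponents stay in place instead of being rescaled, so components multiply as in a ring
  graded by residues modulo \<open>m\<close>.\<close>

definition residue_part :: "nat \<Rightarrow> nat \<Rightarrow> 'a::comm_ring_1 fps \<Rightarrow> 'a fps" where
  "residue_part m r A = Abs_fps (\<lambda>n. if n mod m = r then fps_nth A n else 0)"

lemma residue_part_nth: "fps_nth (residue_part m r A) n = (if n mod m = r then fps_nth A n else 0)"
  by (simp add: residue_part_def)

lemma residue_part_add: "residue_part m r (A + B) = residue_part m r A + residue_part m r B"
  by (simp add: fps_eq_iff residue_part_nth)

lemma residue_part_residue_part:
  "residue_part m r (residue_part m s A) = (if r = s then residue_part m r A else 0)"
  by (auto simp: fps_eq_iff residue_part_nth)

text \<open>Residues of exponents add under multiplication. The complementary residue
  \<open>r - a\<close> is written with \<open>m - a\<close> because natural subtraction truncates at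
  0.\<close>

lemma residue_part_mult:
  assumes "r < m"
  shows "residue_part m r (A * B) = (\<Sum>a<m. residue_part m a A * residue_part m ((r + (m - a)) mod m) B)"
proof (rule fps_ext)
  fix n
  have *: "(\<Sum>a<m. fps_nth (residue_part m a A) i * fps_nth (residue_part m ((r + (m - a)) mod m) B) (n - i))
      = (if n mod m = r then fps_nth A i * fps_nth B (n - i) else 0)" if "i \<le> n" for i
  proof -
    have "(n - i) mod m = (r + (m - i mod m)) mod m \<longleftrightarrow> n mod m = r"
    proof -
      have "(n - i) mod m = (r + (m - i mod m)) mod m \<longleftrightarrow> (n - i + i) mod m = (r + (m - i mod m) + i) mod m"
        unfolding cong_def[symmetric] by (rule cong_add_rcancel_nat[symmetric])
      also have "(r + (m - i mod m) + i) mod m = (r + ((m - i mod m) + i mod m)) mod m"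
        by (metis add.assoc mod_add_right_eq)
      also have "(m - i mod m) + i mod m = m"
        using assms by (simp add: less_imp_le)
      finally show ?thesis
        using that assms by simp
    qed
    moreover have "(\<Sum>a<m. fps_nth (residue_part m a A) i * fps_nth (residue_part m ((r + (m - a)) mod m) B) (n - i))
        = (\<Sum>a<m. if a = i mod m then fps_nth A i * fps_nth (residue_part m ((r + (m - a)) mod m) B) (n - i) else 0)"
      by (intro sum.cong refl) (auto simp: residue_part_nth)
    ultimately show ?thesis
      using assms by (simp add: residue_part_nth)
  qed
  have "fps_nth (\<Sum>a<m. residue_part m a A * residue_part m ((r + (m - a)) mod m) B) n =
     (\<Sum>i=0..n. \<Sum>a<m. fps_nth (residue_part m a A) i * fps_nth (residue_part m ((r + (m - a)) mod m) B) (n - i))"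
    unfolding fps_sum_nth fps_mult_nth by (rule sum.swap)
  also have "\<dots> = (\<Sum>i=0..n. if n mod m = r then fps_nth A i * fps_nth B (n - i) else 0)"
    by (intro sum.cong refl *) auto
  also have "\<dots> = fps_nth (residue_part m r (A * B)) n"
    by (simp add: residue_part_nth fps_mult_nth)
  finally show "fps_nth (residue_part m r (A * B)) n =
     fps_nth (\<Sum>a<m. residue_part m a A * residue_part m ((r + (m - a)) mod m) B) n" ..
qed

text \<open>A series in \<open>fps_X ^ m\<close> is homogeneous of degree 0 for this grading, hence
  acts as a scalar on components.\<close>

lemma residue_part_mult_compose:
  assumes "m > 0"
  shows "residue_part m r (A * (B oo fps_X ^ m)) = residue_part m r A * (B oo fps_X ^ m)"
proof (rule fps_ext)
  fix n
  have eq: "i mod m = n mod m" if "m dvd n - i" "i \<le> n" for i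
    using that mod_eq_dvd_iff_nat[of i n m] by simp
  have "(if n mod m = r then fps_nth A i * fps_nth (B oo fps_X ^ m) (n - i) else 0)
      = fps_nth (residue_part m r A) i * fps_nth (B oo fps_X ^ m) (n - i)" if "i \<le> n" for i
    using assms eq[OF _ that] by (cases "m dvd n - i") (auto simp: residue_part_nth fps_compose_X_power_nth)
  then have "(\<Sum>i=0..n. if n mod m = r then fps_nth A i * fps_nth (B oo fps_X ^ m) (n - i) else 0)
      = (\<Sum>i=0..n. fps_nth (residue_part m r A) i * fps_nth (B oo fps_X ^ m) (n - i))"
    by (intro sum.cong refl) auto
  then show "fps_nth (residue_part m r (A * (B oo fps_X ^ m))) n = fps_nth (residue_part m r A * (B oo fps_X ^ m)) n"
    by (auto simp: residue_part_nth fps_mult_nth split: if_splits)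
qed

lemma residue_part_cong:
  "ring_cong (numeral k) A B \<Longrightarrow> ring_cong (numeral k) (residue_part m r A) (residue_part m r B)"
  for A B :: "'a::comm_ring_1 fps"
  by (auto simp: ring_cong_def numeral_fps_dvd_iff residue_part_nth)

lemma fps_power_11_cong: "ring_cong 11 (A ^ 11) (A oo fps_X ^ 11)" for A :: "int fps"
  using fps_power_prime_cong[of 11 A] by simp

section \<open>Vanishing components of \<open>f_1\<close> and \<open>f_1^3\<close> modulo 11\<close>

text \<open>6 inverts 2 modulo 11; this recovers \<open>n\<close> from the doubled exponents in
  \<open>tri_int\<close> and \<open>pent_int\<close>.\<close>

lemma int_mod_11_double: "int (n mod 11) = (6 * ((2 * int n) mod 11)) mod 11"
proof -
  have "(6 * ((2 * int n) mod 11)) mod 11 = (6 * (2 * int n)) mod 11"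
    by (rule mod_mult_right_eq)
  also have "6 * (2 * int n) = int n + 11 * int n"
    by simp
  finally show ?thesis
    by (simp only: mod_mult_self2 zmod_int of_nat_numeral)
qed

text \<open>Generalized pentagonal numbers only take the residues 0, 1, 2, 4, 5 and 7 modulo
  11.\<close>

lemma residue_part_f_prod_eq_0:
  assumes "s \<in> {3, 6, 8, 9, 10}"
  shows "residue_part 11 s (f_prod 1) = 0"
proof (rule fps_ext)
  fix N
  have "{j. pent j = N} = {}" if "N mod 11 = s"
  proof -
    have "pent j \<noteq> N" for j
    proof
      assume "pent j = N"
      then have "2 * int N = j * (3 * j - 1)"
        using pent_int by metis
      also have "\<dots> = (11 * (j div 11) + j mod 11) * (3 * (11 * (j div 11) + j mod 11) - 1)"
        by simp
      also have "\<dots> = (j mod 11) * (3 * (j mod 11) - 1)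
          + 11 * ((j div 11) * (33 * (j div 11) + 3 * (j mod 11) - 1) + 3 * (j div 11) * (j mod 11))"
        by (simp only: algebra_simps)
      finally have "(2 * int N) mod 11 = ((j mod 11) * (3 * (j mod 11) - 1)) mod 11"
        by (simp only: mod_mult_self2)
      moreover have "j mod 11 \<in> {0,1,2,3,4,5,6,7,8,9,10}"
        by (auto simp: insert_iff) presburger
      ultimately have "(2 * int N) mod 11 \<in> {0, 2, 3, 4, 8, 10}"
        by auto
      moreover note int_mod_11_double[of N]
      ultimately have "int (N mod 11) \<in> {0, 1, 2, 4, 5, 7}"
        by auto
      then show False
        using that assms by auto
    qed
    then show ?thesis
      by blast
  qed
  then show "fps_nth (residue_part 11 s (f_prod 1)) N = fps_nth 0 N"
    unfolding theta_pentagonal[symmetric] by (auto simp: residue_part_nth theta_def)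
qed

text \<open>The only other residue of a triangular number is 4. It occurs only for \<open>j\<close>
  congruent to 6 modulo 11, and there Jacobi's coefficient \<open>2 * j - 1\<close> is divisible by
  11.\<close>

lemma f_prod_cube_nth_dvd:
  assumes "n mod 11 \<notin> {0, 1, 3, 6, 10}"
  shows "11 dvd fps_nth (f_prod 1 ^ 3) n"
proof -
  let ?S = "{j. tri j = n}"
  have "11 dvd 2 * j - 1" if "j \<in> ?S" for j
  proof -
    have "2 * int n = j * (j - 1)"
      using tri_int that by blast
    then have "(2 * int n) mod 11 = ((j mod 11) * (((j mod 11) - 1) mod 11)) mod 11"
      by (simp add: mod_simps)
    moreover have "j mod 11 \<in> {0,1,2,3,4,5,6,7,8,9,10}"
      by (auto simp: insert_iff) presburger
    ultimately have "(2 * int n) mod 11 \<in> {0, 1, 2, 6, 9} \<or> j mod 11 = 6"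
      by auto
    moreover note int_mod_11_double[of n]
    ultimately have "int (n mod 11) \<in> {0, 1, 3, 6, 10} \<or> j mod 11 = 6"
      by auto
    then have "j mod 11 = 6"
      using assms by auto
    then show ?thesis
      by presburger
  qed
  \<comment> \<open>The reflection \<open>j\<close> to \<open>1 - j\<close> preserves
    \<open>tri\<close> and flips \<open>alt\<close>, so this sum is twice the one in
    \<open>theta_cube\<close>, and 2 is invertible modulo 11.\<close>
  then have "11 dvd (\<Sum>j\<in>?S. alt j * (2 * j - 1))"
    by (intro dvd_sum) auto
  also have "(\<Sum>j\<in>?S. alt j * (2 * j - 1)) = (\<Sum>j\<in>?S. alt j * j) + (\<Sum>j\<in>?S. alt j * (j - 1))"
    by (simp add: sum.distrib[symmetric] algebra_simps)
  also have "(\<Sum>j\<in>?S. alt j * (j - 1)) = (\<Sum>j\<in>?S. alt j * j)"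
    by (rule sum.reindex_bij_witness[of _ "\<lambda>j. 1 - j" "\<lambda>j. 1 - j"])
      (auto simp: tri_def alt_def algebra_simps)
  also have "(\<Sum>j\<in>?S. alt j * j) + (\<Sum>j\<in>?S. alt j * j) = - 2 * fps_nth (f_prod 1 ^ 3) n"
    using arg_cong[OF theta_cube, of "\<lambda>A. fps_nth A n"] by (simp add: theta_def)
  finally show ?thesis
    by presburger
qed

text \<open>
  A certificate that the component of degree 6 (mod 11) of the seventh power of
  \<open>a + b + d + e + t\<close>, whose summands have degrees 0, 1, 3, 6 and 10, lies modulo 11 in the ideal
  of the five components of its fourth power in which the series of \<open>f_prod 1\<close> vanishes. It was
  found by linear algebra.
\<close>
lemma ramanujan_certificate:
  fixes a b d e t :: "'a::comm_ring_1"
  defines "c3 \<equiv> 4 * a * a * a * d + 4 * a * b * b * b + 24 * a * b * d * t + 6 * b * b * e * e + 12 * d * e * e * t + 4 * e * t * t * t"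
    and "c6 \<equiv> 4 * a * a * a * e + 6 * a * a * d * d + 24 * a * b * e * t + 4 * b * b * b * d + 12 * b * d * d * t + 4 * e * e * e * t"
    and "c8 \<equiv> 12 * a * b * b * e + 24 * a * d * e * t + 4 * a * t * t * t + 6 * b * b * d * d + 4 * b * e * e * e + 4 * d * d * d * t"
    and "c9 \<equiv> 12 * a * a * d * e + 6 * a * a * t * t + 4 * a * d * d * d + 4 * b * b * b * e + 24 * b * d * e * t + 4 * b * t * t * t"
    and "c10 \<equiv> 4 * a * a * a * t + 24 * a * b * d * e + 12 * a * b * t * t + 4 * b * d * d * d + 4 * d * e * e * e + 6 * e * e * t * t"
  shows "7 * a * a * a * a * a * a * e + 21 * a * a * a * a * a * d * d + 210 * a * a * a * a * b * e * t + 140 * a * a * a * b * b * b * d + 420 * a * a * a * b * d * d * t + 140 * a * a * a * e * e * e * t + 630 * a * a * b * b * d * e * e + 630 * a * a * b * b * e * t * t + 630 * a * a * d * d * e * e * t + 420 * a * a * d * e * t * t * t + 21 * a * a * t * t * t * t * t + 7 * a * b * b * b * b * b * b + 210 * a * b * b * b * b * d * t + 420 * a * b * b * d * d * d * e + 630 * a * b * b * d * d * t * t + 210 * a * b * d * e * e * e * e + 420 * a * b * e * e * e * t * t + 210 * a * d * d * d * d * e * t + 140 * a * d * d * d * t * t * t + 21 * b * b * b * b * b * e * e + 420 * b * b * b * d * e * e * t + 140 * b * b * b * e * t * t * t + 21 * b * b * d * d * d * d * d + 140 * b * d * d * d * e * e * e + 630 * b * d * d * e * e * t * t + 210 * b *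 d * e * t * t * t * t + 7 * b * t * t * t * t * t * t + 7 * d * d * d * d * d * d * t + 7 * d * e * e * e * e * e * e + 21 * e * e * e * e * e * t * t
   = c3 * (4 * a * a * d - b * b * b - b * d * t) + c6 * (4 * e * e * t - a * a * a - a * b * t)
   + c8 * (4 * a * t * t - a * d * e - d * d * d) + c9 * (4 * b * b * e - d * e * t - t * t * t)
   + c10 * (4 * b * d * d - a * b * e - e * e * e)
   + 11 * (a * a * a * a * a * a * e + a * a * a * a * a * d * d + 22 * a * a * a * a * b * e * t + 12 * a * a * a * b * b * b * d + 30 * a * a * a * b * d * d * t + 12 * a * a * a * e * e * e * t + 54 * a * a * b * b * d * e * e + 54 * a * a * b * b * e * t * t + 54 * a * a * d * d * e * e * t + 30 * a * a * d * e * t * t * t + a * a * t * t * t * t * t + a * b * b * b * b * b * b + 22 * a * b * b * b * b * d * t + 30 * a * b * b * d * d * d * e + 54 * a * b * b * d * d * t * t + 22 * a * b * d * e * e * e * e + 30 * a * b * e * e * e * t * t + 22 * a * d * d * d * d * e * t + 12 * a * d * d * d * t * t * t + b * b * b * b * b * e * e + 30 * b * b * b * d * e * e * t + 12 * b * b * b * e * t * t * t + b * b * d * d * d * d * d + 12 * b * d * d * d * e * e * e + 54 * b * d * d * e * e * t * t + 22 * b * d * e * t * t * t * t + b * t * t * t * t * t * t + d * d * d * d * d * d * t + d * e * e * e * e * e * e + e * e * e * e * e * t * t)"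
  unfolding c3_def c6_def c8_def c9_def c10_def by (simp add: algebra_simps)

lemma ramanujan_11: "11 dvd fps_nth p_ser (11 * n + 6)"
proof -
  define F where "F = f_prod 1"
  define a b d e t where "a = residue_part 11 0 (F ^ 3)" and "b = residue_part 11 1 (F ^ 3)"
    and "d = residue_part 11 3 (F ^ 3)" and "e = residue_part 11 6 (F ^ 3)" and "t = residue_part 11 10 (F ^ 3)"
  \<comment> \<open>\<open>J\<close> is \<open>F ^ 3\<close> without the components that are
    divisible by 11.\<close>
  define J where "J = a + b + d + e + t"
  have F3: "ring_cong 11 (F ^ 3) J"
    using f_prod_cube_nth_dvd unfolding ring_cong_def numeral_fps_dvd_iff
    by (auto simp: J_def a_def b_def d_def e_def t_def F_def residue_part_nth)
  have J1: "residue_part 11 0 J = a" "residue_part 11 1 J = b" "residue_part 11 2 J = 0" "residue_part 11 3 J = d"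
    "residue_part 11 4 J = 0" "residue_part 11 5 J = 0" "residue_part 11 6 J = e" "residue_part 11 7 J = 0"
    "residue_part 11 8 J = 0" "residue_part 11 9 J = 0" "residue_part 11 10 J = t"
    by (simp_all add: J_def a_def b_def d_def e_def t_def residue_part_add residue_part_residue_part)
  have expand: "(\<Sum>i<11. f i) = f 0 + f 1 + f 2 + f 3 + f 4 + f 5 + f 6 + f 7 + f 8 + f 9 + f 10"
    for f :: "nat \<Rightarrow> int fps"
    by (simp add: eval_nat_numeral)
  \<comment> \<open>The powers \<open>K = J^2\<close>, \<open>T = J^3\<close> and
    \<open>G = J^4\<close> are expanded by degree modulo 11. Five components of \<open>G\<close> are
    the generators in the certificate, and \<open>J^7 = G * T\<close>.\<close>
  define K where "K = J * J"
  have J2: "residue_part 11 0 K = a * a + 2 * b * t"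
    "residue_part 11 1 K = 2 * a * b + e * e"
    "residue_part 11 2 K = b * b + 2 * d * t"
    "residue_part 11 3 K = 2 * a * d"
    "residue_part 11 4 K = 2 * b * d"
    "residue_part 11 5 K = 2 * e * t"
    "residue_part 11 6 K = 2 * a * e + d * d"
    "residue_part 11 7 K = 2 * b * e"
    "residue_part 11 8 K = 0"
    "residue_part 11 9 K = 2 * d * e + t * t"
    "residue_part 11 10 K = 2 * a * t"
    by (simp_all add: residue_part_mult expand J1 J1(2,3)[unfolded One_nat_def numeral_2_eq_2] K_def algebra_simps)
  define T where "T = K * J"
  have J3: "residue_part 11 0 T = a * a * a + 6 * a * b * t + 3 * e * e * t"
    "residue_part 11 1 T = 3 * a * a * b + 3 * a * e * e + 3 * b * b * t + 3 * d * d * e + 3 * d * t * t"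
    "residue_part 11 2 T = 3 * a * b * b + 6 * a * d * t + 3 * b * e * e"
    "residue_part 11 3 T = 3 * a * a * d + b * b * b + 6 * b * d * t"
    "residue_part 11 4 T = 6 * a * b * d + 3 * d * e * e + 3 * e * t * t"
    "residue_part 11 5 T = 6 * a * e * t + 3 * b * b * d + 3 * d * d * t"
    "residue_part 11 6 T = 3 * a * a * e + 3 * a * d * d + 6 * b * e * t"
    "residue_part 11 7 T = 6 * a * b * e + 3 * b * d * d + e * e * e"
    "residue_part 11 8 T = 3 * b * b * e + 6 * d * e * t + t * t * t"
    "residue_part 11 9 T = 6 * a * d * e + 3 * a * t * t + d * d * d"
    "residue_part 11 10 T = 3 * a * a * t + 6 * b * d * e + 3 * b * t * t"
    unfolding T_def
    by (simp_all add: residue_part_mult expand J1 J1(2,3)[unfolded One_nat_def numeral_2_eq_2] J2 J2(2,3)[unfolded One_nat_def numeral_2_eq_2] algebra_simps)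
  define G where "G = K * K"
  have J4: "residue_part 11 0 G = a * a * a * a + 12 * a * a * b * t + 12 * a * e * e * t + 12 * b * b * d * e + 6 * b * b * t * t + 12 * d * d * e * t + 4 * d * t * t * t"
    "residue_part 11 1 G = 4 * a * a * a * b + 6 * a * a * e * e + 12 * a * b * b * t + 12 * a * d * d * e + 12 * a * d * t * t + 12 * b * e * e * t + d * d * d * d"
    "residue_part 11 2 G = 6 * a * a * b * b + 12 * a * a * d * t + 12 * a * b * e * e + 4 * b * b * b * t + 12 * b * d * d * e + 12 * b * d * t * t + e * e * e * e"
    "residue_part 11 3 G = 4 * a * a * a * d + 4 * a * b * b * b + 24 * a * b * d * t + 6 * b * b * e * e + 12 * d * e * e * t + 4 * e * t * t * t"
    "residue_part 11 4 G = 12 * a * a * b * d + 12 * a * d * e * e + 12 * a * e * t * t + b * b * b * b + 12 * b * b * d * t + 4 * d * d * d * e + 6 * d * d * t * t"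
    "residue_part 11 5 G = 12 * a * a * e * t + 12 * a * b * b * d + 12 * a * d * d * t + 12 * b * d * e * e + 12 * b * e * t * t"
    "residue_part 11 6 G = 4 * a * a * a * e + 6 * a * a * d * d + 24 * a * b * e * t + 4 * b * b * b * d + 12 * b * d * d * t + 4 * e * e * e * t"
    "residue_part 11 7 G = 12 * a * a * b * e + 12 * a * b * d * d + 4 * a * e * e * e + 12 * b * b * e * t + 6 * d * d * e * e + 12 * d * e * t * t + t * t * t * t"
    "residue_part 11 8 G = 12 * a * b * b * e + 24 * a * d * e * t + 4 * a * t * t * t + 6 * b * b * d * d + 4 * b * e * e * e + 4 * d * d * d * t"
    "residue_part 11 9 G = 12 * a * a * d * e + 6 * a * a * t * t + 4 * a * d * d * d + 4 * b * b * b * e + 24 * b * d * e * t + 4 * b * t * t * t"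
    "residue_part 11 10 G = 4 * a * a * a * t + 24 * a * b * d * e + 12 * a * b * t * t + 4 * b * d * d * d + 4 * d * e * e * e + 6 * e * e * t * t"
    unfolding G_def
    by (simp_all add: residue_part_mult expand J2 J2(2,3)[unfolded One_nat_def numeral_2_eq_2] algebra_simps)
  \<comment> \<open>\<open>G\<close> is congruent to \<open>F^12 = F * F^11\<close>, and
    \<open>F^11\<close> to a series in \<open>fps_X ^ 11\<close>; hence components of
    \<open>G\<close> vanish modulo 11 wherever those of \<open>F\<close> vanish.\<close>
  have c: "11 dvd residue_part 11 s G" if "s \<in> {3, 6, 8, 9, 10}" for s
  proof -
    have "ring_cong 11 ((F ^ 3) ^ 4) (J ^ 4)"
      by (intro ring_cong_power F3)
    then have "ring_cong 11 G (F * F ^ 11)"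
      by (simp add: G_def K_def power4_eq_xxxx mult.assoc flip: power_mult power_Suc) (rule ring_cong_sym)
    also have "ring_cong 11 \<dots> (F * (F oo fps_X ^ 11))"
      by (intro ring_cong_mult ring_cong_refl fps_power_11_cong)
    finally have "ring_cong 11 (residue_part 11 s G) (residue_part 11 s (F * (F oo fps_X ^ 11)))"
      by (rule residue_part_cong)
    also have "residue_part 11 s (F * (F oo fps_X ^ 11)) = 0"
      using residue_part_f_prod_eq_0[OF that] by (simp add: residue_part_mult_compose F_def)
    finally show ?thesis
      by (simp add: ring_cong_0_iff)
  qed
  have "residue_part 11 6 (G * T) = residue_part 11 3 G * (4 * a * a * d - b * b * b - b * d * t)
   + residue_part 11 6 G * (4 * e * e * t - a * a * a - a * b * t)
   + residue_part 11 8 G * (4 * a * t * t - a * d * e - d * d * d)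
   + residue_part 11 9 G * (4 * b * b * e - d * e * t - t * t * t)
   + residue_part 11 10 G * (4 * b * d * d - a * b * e - e * e * e)
   + 11 * (a * a * a * a * a * a * e + a * a * a * a * a * d * d + 22 * a * a * a * a * b * e * t + 12 * a * a * a * b * b * b * d + 30 * a * a * a * b * d * d * t + 12 * a * a * a * e * e * e * t + 54 * a * a * b * b * d * e * e + 54 * a * a * b * b * e * t * t + 54 * a * a * d * d * e * e * t + 30 * a * a * d * e * t * t * t + a * a * t * t * t * t * t + a * b * b * b * b * b * b + 22 * a * b * b * b * b * d * t + 30 * a * b * b * d * d * d * e + 54 * a * b * b * d * d * t * t + 22 * a * b * d * e * e * e * e + 30 * a * b * e * e * e * t * t + 22 * a * d * d * d * d * e * t + 12 * a * d * d * d * t * t * t + b * b * b * b * b * e * e + 30 * b * b * b * d * e * e * t + 12 * b * b * b * e * t * t * t + b * b * d * d * d * d * d + 12 * b * d * d * d * e * e * e + 54 * b * d * d * e * e * t * t + 22 * b * d * e * t * t * t * t + b * t * t * t * t * t * t + d * d * d * d * d * d * t + d * e * e * e * e * e * e + e * e * e * e * e * t * t)"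
    unfolding J4 ramanujan_certificate[symmetric]
    by (simp add: residue_part_mult expand J3 J3(2)[unfolded One_nat_def] J4 J4(2)[unfolded One_nat_def] algebra_simps)
  then have "11 dvd residue_part 11 6 (G * T)"
    by (elim ssubst) (intro dvd_add dvd_mult2 dvd_triv_left c; simp)
  then have J7: "11 dvd residue_part 11 6 (J ^ 7)"
    by (simp add: G_def K_def T_def eval_nat_numeral mult_ac)
  \<comment> \<open>That is, \<open>1 / F = F^21 / F^22\<close>; the denominator is an 11th power
    and so becomes a series in \<open>fps_X ^ 11\<close>.\<close>
  have "p_ser = (F ^ 3) ^ 7 * (p_ser ^ 11) ^ 2"
  proof -
    have Fp: "F * p_ser = 1"
      using f_prod_p_ser[of 1] by (simp add: F_def)
    have "(F ^ 3) ^ 7 * (p_ser ^ 11) ^ 2 = (F * p_ser) ^ 21 * p_ser"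
      by (simp add: power_mult_distrib flip: power_mult power_Suc2)
    then show ?thesis
      by (simp add: Fp)
  qed
  also have "ring_cong 11 \<dots> (J ^ 7 * (p_ser oo fps_X ^ 11) ^ 2)"
    by (intro ring_cong_mult ring_cong_power F3 fps_power_11_cong)
  also have "\<dots> = J ^ 7 * (p_ser ^ 2 oo fps_X ^ 11)"
    by (simp add: fps_compose_X_power_distrib)
  finally have "ring_cong 11 (residue_part 11 6 p_ser) (residue_part 11 6 (J ^ 7 * (p_ser ^ 2 oo fps_X ^ 11)))"
    by (rule residue_part_cong)
  also have "\<dots> = residue_part 11 6 (J ^ 7) * (p_ser ^ 2 oo fps_X ^ 11)"
    by (simp add: residue_part_mult_compose)
  also have "ring_cong 11 \<dots> 0"
    using J7 by (simp add: ring_cong_0_iff)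
  finally have "11 dvd fps_nth (residue_part 11 6 p_ser) (11 * n + 6)"
    by (simp add: ring_cong_0_iff numeral_fps_dvd_iff)
  moreover have "(11 * n + 6) mod 11 = 6"
    by presburger
  ultimately show ?thesis
    by (simp add: residue_part_nth)
qed

section \<open>Generating functions and binary theta series\<close>

definition weighted_multisets :: "(nat \<times> nat) set \<Rightarrow> nat \<Rightarrow> (nat \<times> nat) multiset set" where
  "weighted_multisets S n = {P. set_mset P \<subseteq> S \<and> (\<Sum>(p, c) \<in># P. p) = n}"

lemma finite_weighted_multisets:
  assumes "finite S" "\<And>p c. (p, c) \<in> S \<Longrightarrow> p > 0"
  shows "finite (weighted_multisets S n)"
proof -
  have "size P \<le> (\<Sum>(p, c) \<in># P. p)" if "set_mset P \<subseteq> S" for P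
    using that
  proof (induction P)
    case (add s P)
    have "fst s > 0"
      using add.prems assms(2)[of "fst s" "snd s"] by auto
    then show ?case
      using add by (auto simp: case_prod_unfold)
  qed simp
  then have "weighted_multisets S n \<subseteq> (\<Union>k\<le>n. multisets_of_size S k)"
    by (auto simp: weighted_multisets_def multisets_of_size_def)
  moreover have "finite (\<Union>k\<le>n. multisets_of_size S k)"
    using assms(1) by auto
  ultimately show ?thesis
    by (rule finite_subset)
qed

text \<open>Multisets either avoid the new part or contain it, and in the second case removing one
  copy is a bijection. This is the recursion for the factor
  \<open>1 / (1 - fps_X ^ p0)\<close>.\<close>

lemma card_weighted_multisets_insert:
  assumes "finite S" "\<And>p c. (p, c) \<in> insert (p0, c0) S \<Longrightarrow> p > 0" "(p0, c0) \<notin> S"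
  shows "card (weighted_multisets (insert (p0, c0) S) n) =
    card (weighted_multisets S n) + (if n < p0 then 0 else card (weighted_multisets (insert (p0, c0) S) (n - p0)))"
proof -
  let ?s = "(p0, c0)"
  let ?B = "{P \<in> weighted_multisets (insert ?s S) n. ?s \<in># P}"
  have fin: "finite (weighted_multisets (insert ?s S) n)"
    using assms(1,2) by (intro finite_weighted_multisets) auto
  have split: "weighted_multisets (insert ?s S) n = weighted_multisets S n \<union> ?B"
    by (auto simp: weighted_multisets_def)
  have "card (weighted_multisets (insert ?s S) n) = card (weighted_multisets S n \<union> ?B)"
    by (rule arg_cong[OF split])
  also have "\<dots> = card (weighted_multisets S n) + card ?B"
  proof (rule card_Un_disjoint)
    show "finite (weighted_multisets S n)" "finite ?B"
      by (rule finite_subset[OF _ fin], auto simp: weighted_multisets_def)+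
    show "weighted_multisets S n \<inter> ?B = {}"
      using assms(3) by (auto simp: weighted_multisets_def)
  qed
  also have "card ?B = (if n < p0 then 0 else card (weighted_multisets (insert ?s S) (n - p0)))"
  proof (cases "n < p0")
    case True
    have "?B = {}"
      using True by (auto simp: weighted_multisets_def dest!: multi_member_split)
    then show ?thesis
      using True by (simp only: card.empty if_True)
  next
    case False
    have "?B = add_mset ?s ` weighted_multisets (insert ?s S) (n - p0)"
    proof (intro equalityI subsetI)
      fix P assume "P \<in> ?B"
      moreover from this obtain Q where "P = add_mset ?s Q"
        by (auto dest!: multi_member_split)
      ultimately show "P \<in> add_mset ?s ` weighted_multisets (insert ?s S) (n - p0)"
        by (auto simp: weighted_multisets_def)
    qed (use False in \<open>auto simp: weighted_multisets_def\<close>)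
    then show ?thesis
      using False by (simp add: card_image inj_on_def)
  qed
  finally show ?thesis .
qed

lemma weighted_multisets_generating_function:
  assumes "finite S" "\<And>p c. (p, c) \<in> S \<Longrightarrow> p > 0"
  shows "Abs_fps (\<lambda>n. int (card (weighted_multisets S n))) * (\<Prod>(p, c)\<in>S. 1 - fps_X ^ p) = 1"
  using assms
proof (induction S)
  case empty
  have "weighted_multisets {} n = (if n = 0 then {{#}} else {})" for n
    by (auto simp: weighted_multisets_def)
  then show ?case
    by (auto simp: fps_eq_iff)
next
  case (insert s S)
  obtain p c where s: "s = (p, c)"
    by fastforce
  let ?C = "\<lambda>S. Abs_fps (\<lambda>n. int (card (weighted_multisets S n)))"
  have "card (weighted_multisets (insert s S) n) =
      card (weighted_multisets S n) + (if n < p then 0 else card (weighted_multisets (insert s S) (n - p)))" for n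
    unfolding s using insert.hyps insert.prems by (intro card_weighted_multisets_insert) (auto simp: s)
  then have "?C (insert s S) * (1 - fps_X ^ p) = ?C S"
    by (simp add: fps_eq_iff right_diff_distrib fps_X_power_mult_right_nth)
  moreover have "?C S * (\<Prod>(p, c)\<in>S. 1 - fps_X ^ p) = 1"
    using insert by auto
  ultimately show ?case
    using insert.hyps by (simp add: s flip: mult.assoc)
qed

definition cubic_parts :: "nat \<Rightarrow> nat \<Rightarrow> (nat \<times> nat) set" where
  "cubic_parts k N = (SIGMA p:{1..N}. if even p then {..<k} else {0})"

text \<open>Of the \<open>k\<close> factors for an even part, one joins the odd parts in
  \<open>qpoch q (2 * M)\<close> and \<open>k - 1\<close> go to \<open>qpoch (q ^ 2) M\<close>. With
  an even bound, each induction step adds one odd and one even part.\<close>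

lemma cubic_parts_prod:
  assumes "k \<ge> 1"
  shows "(\<Prod>(p, c)\<in>cubic_parts k (2 * M). 1 - q ^ p) = qpoch q (2 * M) * qpoch (q ^ 2) M ^ (k - 1)"
proof -
  have "(\<Prod>(p, c)\<in>cubic_parts k (2 * M). 1 - q ^ p) = (\<Prod>p\<in>{1..2 * M}. \<Prod>c\<in>(if even p then {..<k} else {0}). 1 - q ^ p)"
    unfolding cubic_parts_def by (rule prod.Sigma[symmetric]) auto
  also have "\<dots> = (\<Prod>p\<in>{1..2 * M}. (1 - q ^ p) ^ (if even p then k else 1))"
    by (intro prod.cong) auto
  also have "\<dots> = qpoch q (2 * M) * qpoch (q ^ 2) M ^ (k - 1)"
  proof (induction M)
    case 0
    then show ?case
      by (simp add: qpoch_def)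
  next
    case (Suc M)
    have k: "(1 - q ^ p) ^ k = (1 - q ^ p) * (1 - q ^ p) ^ (k - 1)" for p
      using assms by (metis Suc_diff_1 less_eq_Suc_le One_nat_def power_Suc)
    have "(\<Prod>p\<in>{1..2 * Suc M}. (1 - q ^ p) ^ (if even p then k else 1))
        = (\<Prod>p\<in>{1..2 * M}. (1 - q ^ p) ^ (if even p then k else 1)) * (1 - q ^ Suc (2 * M)) * (1 - q ^ Suc (Suc (2 * M))) ^ k"
      by (simp del: power_Suc)
    also have "\<dots> = (qpoch q (2 * M) * (1 - q ^ Suc (2 * M)) * (1 - q ^ Suc (Suc (2 * M))))
        * (qpoch (q ^ 2) M * (1 - q ^ Suc (Suc (2 * M)))) ^ (k - 1)"
      unfolding Suc k by (simp only: power_mult_distrib mult_ac)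
    also have "qpoch (q ^ 2) M * (1 - q ^ Suc (Suc (2 * M))) = qpoch (q ^ 2) (Suc M)"
      by (simp add: qpoch_def del: power_Suc flip: power_mult)
    also have "qpoch q (2 * M) * (1 - q ^ Suc (2 * M)) * (1 - q ^ Suc (Suc (2 * M))) = qpoch q (2 * Suc M)"
      by (simp add: qpoch_def del: power_Suc)
    finally show ?case .
  qed
  finally show ?thesis .
qed

lemma a_cubic_eq_card:
  assumes "n \<le> N"
  shows "a_cubic k n = card (weighted_multisets (cubic_parts k N) n)"
proof -
  have "p \<le> N" if "(\<Sum>(p, c) \<in># P. p) = n" "(p, c) \<in># P" for P p c
    using that assms by (auto dest!: multi_member_split)
  note le = this
  have iff: "(p, c) \<in> cubic_parts k N \<longleftrightarrow> p > 0 \<and> p \<le> N \<and> (if even p then c < k else c = 0)" for p c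
    by (auto simp: cubic_parts_def)
  have "(\<forall>(p, c) \<in># P. p > 0 \<and> (if even p then c < k else c = 0)) \<longleftrightarrow> set_mset P \<subseteq> cubic_parts k N"
    if "(\<Sum>(p, c) \<in># P. p) = n" for P
    using le[OF that] unfolding subset_iff Ball_def split_paired_All by (auto simp: iff)
  then have "cubic_partitions k n = weighted_multisets (cubic_parts k N) n"
    unfolding cubic_partitions_def weighted_multisets_def by blast
  then show ?thesis
    by (simp add: a_cubic_def)
qed

lemma a_cubic_generating_function:
  assumes "k \<ge> 1"
  shows "Abs_fps (\<lambda>n. int (a_cubic k n)) * (f_prod 1 * f_prod 2 ^ (k - 1)) = 1"
proof (rule fps_eq_if_ring_cong)
  fix n
  let ?C = "Abs_fps (\<lambda>i. int (card (weighted_multisets (cubic_parts k (2 * n)) i)))"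
  have "ring_cong (fps_X ^ n) (Abs_fps (\<lambda>n. int (a_cubic k n)) * (f_prod 1 * f_prod 2 ^ (k - 1)))
      (?C * (qpoch (fps_X ^ 1) (2 * n) * qpoch (fps_X ^ 2) n ^ (k - 1)))"
  proof (intro ring_cong_mult ring_cong_power ring_cong_sym[OF f_prod_cong'])
    show "ring_cong (fps_X ^ n) (Abs_fps (\<lambda>n. int (a_cubic k n))) ?C"
      by (simp add: ring_cong_fps_X_power_iff a_cubic_eq_card)
  qed auto
  also have "qpoch (fps_X ^ 1) (2 * n) * qpoch (fps_X ^ 2) n ^ (k - 1) = (\<Prod>(p, c)\<in>cubic_parts k (2 * n). 1 - fps_X ^ p :: int fps)"
    using cubic_parts_prod[OF assms, where q = "fps_X :: int fps" and M = n] by simp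
  also have "?C * \<dots> = 1"
    by (rule weighted_multisets_generating_function) (auto simp: cubic_parts_def)
  finally show "ring_cong (fps_X ^ n) (Abs_fps (\<lambda>n. int (a_cubic k n)) * (f_prod 1 * f_prod 2 ^ (k - 1))) 1" .
qed

section \<open>Coefficients of products of two theta series\<close>

text \<open>The growth bounds confine the representations of \<open>N\<close> to a finite box, so
  the Cauchy product regroups into one finite sum.\<close>

lemma theta_mult_nth:
  assumes "\<And>j. \<bar>j\<bar> \<le> int (e j) + 1" "\<And>j. \<bar>j\<bar> \<le> int (e' j) + 1"
  shows "fps_nth (theta e c * theta e' c') N = (\<Sum>(i, j)\<in>{(i, j). e i + e' j = N}. c i * c' j)"
proof -
  let ?S = "{(i, j). e i + e' j = N}"
  have "?S \<subseteq> {-int N - 1..int N + 1} \<times> {-int N - 1..int N + 1}"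
  proof clarify
    fix i j assume "N = e i + e' j"
    then show "i \<in> {-int (e i + e' j) - 1..int (e i + e' j) + 1} \<and> j \<in> {-int (e i + e' j) - 1..int (e i + e' j) + 1}"
      using assms(1)[of i] assms(2)[of j] by auto
  qed
  then have fin: "finite ?S"
    by (rule finite_subset) auto
  have "fps_nth (theta e c * theta e' c') N = (\<Sum>k=0..N. \<Sum>(i, j)\<in>{i. e i = k} \<times> {j. e' j = N - k}. c i * c' j)"
    by (simp add: fps_mult_nth theta_def sum_product sum.cartesian_product)
  also have "\<dots> = (\<Sum>k=0..N. \<Sum>(i, j)\<in>{x\<in>?S. e (fst x) = k}. c i * c' j)"
    by (intro sum.cong refl) auto
  also have "\<dots> = (\<Sum>(i, j)\<in>?S. c i * c' j)"
    by (rule sum.group[OF fin]) auto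
  finally show ?thesis .
qed

lemma theta_compose:
  assumes "m > 0"
  shows "theta e c oo fps_X ^ m = theta (\<lambda>j. m * e j) c"
proof (rule fps_ext)
  fix n
  show "fps_nth (theta e c oo fps_X ^ m) n = fps_nth (theta (\<lambda>j. m * e j) c) n"
  proof (cases "m dvd n")
    case True
    then have "{j. e j = n div m} = {j. m * e j = n}"
      using assms by auto
    then show ?thesis
      using True assms by (simp add: fps_compose_X_power_nth theta_def)
  next
    case False
    then have "{j. m * e j = n} = {}"
      by auto
    then show ?thesis
      using False assms by (simp add: fps_compose_X_power_nth theta_def)
  qed
qed

text \<open>
  In the variables \<open>x = 2 i - 1\<close> and \<open>y = 6 j - 1\<close> the exponents are governed by
  \<open>24 N + 5 = 3 x\<^sup>2 + 2 y\<^sup>2\<close>, and 11 splits in \<open>\<rat>(\<surd>-6)\<close>. The rotation by \<open>(5 + 4\<surd>-6) / 11\<close>,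
  followed by \<open>x \<mapsto> -x\<close>, is an involution of the representations lying in one of the two primes
  above 11, and it flips the sign.
\<close>
lemma triangular_pentagonal_sum_eq_0:
  "(\<Sum>(i, j)\<in>{(i, j). tri i + 2 * pent j = N \<and> 11 dvd i + 4 * j - 3}. alt j) = 0"
proof -
  let ?S = "{(i, j). tri i + 2 * pent j = N \<and> 11 dvd i + 4 * j - 3}"
  let ?T = "{(t, j). 22 * j * j - 88 * j * t + 121 * t * t - 22 * j + 55 * t + 6 = 2 * int N}"
  have N: "tri i + 2 * pent j = N \<longleftrightarrow> i * (i - 1) + 2 * (j * (3 * j - 1)) = 2 * int N" for i j
    unfolding tri_int[symmetric] pent_int[symmetric] by linarith
  have poly: "i * (i - 1) + 2 * (j * (3 * j - 1)) = 22 * j * j - 88 * j * t + 121 * t * t - 22 * j + 55 * t + 6"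
    if "i = 3 - 4 * j + 11 * t" for i j t :: int
    unfolding that by (simp add: algebra_simps)
  have "?S = (\<lambda>(t, j). (3 - 4 * j + 11 * t, j)) ` ?T"
  proof (intro equalityI subsetI)
    fix x assume "x \<in> ?S"
    then obtain i j where x: "x = (i, j)" "i * (i - 1) + 2 * (j * (3 * j - 1)) = 2 * int N" "11 dvd i + 4 * j - 3"
      unfolding N by auto
    then obtain t where "i + 4 * j - 3 = 11 * t"
      by (auto elim: dvdE)
    then have t: "i = 3 - 4 * j + 11 * t"
      by simp
    have "(t, j) \<in> ?T"
      using x(2) poly[OF t] by simp
    then show "x \<in> (\<lambda>(t, j). (3 - 4 * j + 11 * t, j)) ` ?T"
      unfolding x(1) t by (rule rev_image_eqI) simp
  next
    fix x assume "x \<in> (\<lambda>(t, j). (3 - 4 * j + 11 * t, j)) ` ?T"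
    then obtain t j where x: "x = (3 - 4 * j + 11 * t, j)" "(t, j) \<in> ?T"
      by auto
    then show "x \<in> ?S"
      using poly[OF refl, of j t] unfolding N by simp
  qed
  then have "(\<Sum>(i, j)\<in>?S. alt j) = (\<Sum>(t, j)\<in>?T. alt j)"
    by (simp add: sum.reindex inj_on_def case_prod_unfold)
  \<comment> \<open>For fixed \<open>t\<close> the form depends on \<open>j\<close> through
    \<open>j * j - (4 * t + 1) * j\<close>, which is invariant under \<open>j\<close> to
    \<open>4 * t + 1 - j\<close>; as \<open>4 * t + 1\<close> is odd, the sign flips.\<close>
  moreover have "(\<Sum>(t, j)\<in>?T. alt j) = (\<Sum>(t, j)\<in>?T. - alt j)"
    by (rule sum.reindex_bij_witness[of _ "\<lambda>(t, j). (t, 1 - j + 4 * t)" "\<lambda>(t, j). (t, 1 - j + 4 * t)"])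
      (auto simp: alt_def algebra_simps)
  ultimately show ?thesis
    by (simp add: case_prod_unfold sum_negf)
qed

lemma mod_121_of_double:
  assumes "2 * int N = 2 * int r + 121 * x"
  shows "N mod 121 = r mod 121"
proof -
  \<comment> \<open>61 inverts 2 modulo 121.\<close>
  have "int N = int r + 121 * (int r + 61 * x - int N)"
    using assms by simp
  then have "int N mod 121 = int r mod 121"
    by (metis mod_mult_self2)
  then have "int (N mod 121) = int (r mod 121)"
    by (simp only: zmod_int of_nat_numeral)
  then show ?thesis
    by (simp only: of_nat_eq_iff)
qed

text \<open>Modulo 11 the representations lie on two lines, one for each prime above 11, exchanged
  by \<open>i\<close> to \<open>1 - i\<close>. The signed sum over each line is 0, and the lines
  only meet when \<open>N\<close> is 25 modulo 121.\<close>

lemma triangular_pentagonal_nth_eq_0: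
  assumes "N mod 11 = 3" "N mod 121 \<noteq> 25"
  shows "fps_nth (theta tri (\<lambda>_. 1) * f_prod 2) N = 0"
proof -
  let ?S = "\<lambda>P. {(i, j). tri i + 2 * pent j = N \<and> P i j}"
  have N: "i * (i - 1) + 2 * (j * (3 * j - 1)) = 2 * int N" if "tri i + 2 * pent j = N" for i j
    unfolding tri_int[symmetric] pent_int[symmetric] using that by linarith
  have e: "\<bar>j\<bar> \<le> int (2 * pent j) + 1" for j
    using abs_le_pent[of j] by simp
  have fin: "finite (?S (\<lambda>i j. True))"
  proof (rule finite_subset)
    show "?S (\<lambda>i j. True) \<subseteq> {-int N - 1..int N + 1} \<times> {-int N - 1..int N + 1}"
    proof clarify
      fix i j assume "N = tri i + 2 * pent j"
      then show "i \<in> {-int (tri i + 2 * pent j) - 1..int (tri i + 2 * pent j) + 1}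
          \<and> j \<in> {-int (tri i + 2 * pent j) - 1..int (tri i + 2 * pent j) + 1}"
        using abs_le_tri[of i] e[of j] by auto
    qed
  qed auto
  let ?P1 = "\<lambda>i j. 11 dvd i + 4 * j - 3" and ?P2 = "\<lambda>i j. 11 dvd (1 - i) + 4 * j - (3 :: int)"
  have split: "?S (\<lambda>i j. True) = ?S ?P1 \<union> ?S ?P2"
  proof -
    have "?P1 i j \<or> ?P2 i j" if "tri i + 2 * pent j = N" for i j
    proof -
      obtain M where M: "int N = 3 + 11 * M"
        using assms(1) by (metis mod_div_decomp zmod_int of_nat_numeral add.commute mult.commute)
      \<comment> \<open>On representations of \<open>N\<close> the product equals
        \<open>22 * j * j - 22 * j + 6 - 2 * N\<close>, and 11 divides
        \<open>6 - 2 * N\<close>.\<close>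
      have "(i + 4 * j - 3) * ((1 - i) + 4 * j - 3) = 11 * (2 * j * j - 2 * j - 2 * M)"
        using N[OF that] M by (simp add: algebra_simps)
      then have "11 dvd (i + 4 * j - 3) * ((1 - i) + 4 * j - 3)"
        by simp
      moreover have "prime (11 :: int)"
        by simp
      ultimately show ?thesis
        by (simp only: prime_dvd_mult_iff)
    qed
    then show ?thesis
      by auto
  qed
  have disj: "?S ?P1 \<inter> ?S ?P2 = {}"
  proof -
    have False if "tri i + 2 * pent j = N" "?P1 i j" "?P2 i j" for i j
    proof -
      note that' = that
      obtain a b where ab: "i + 4 * j - 3 = 11 * a" "(1 - i) + 4 * j - 3 = 11 * b"
        using that'(2,3) by (elim dvdE)
      \<comment> \<open>Adding the two conditions gives \<open>8 * j - 5 = 11 * (a + b)\<close>.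
        Since 7 inverts 8 modulo 11, \<open>j\<close> is 2 and then \<open>i\<close> is 6 modulo 11,
        with quotients \<open>v\<close> and \<open>u\<close>; the base point has
        \<open>tri 6 + 2 * pent 2 = 25\<close>.\<close>
      define v where "v = 3 + 7 * (a + b) - 5 * j"
      define u where "u = a - 1 - 4 * v"
      have j: "j = 2 + 11 * v"
        using ab by (simp add: v_def)
      then have "i = 6 + 11 * u"
        using ab(1) by (simp add: u_def)
      then have "2 * int N = 2 * int 25 + 121 * (u + u * u + 2 * v + 6 * v * v)"
        using N[OF that(1)] unfolding j by (simp add: algebra_simps)
      from mod_121_of_double[OF this] show False
        using assms(2) by simp
    qed
    then show ?thesis
      by auto
  qed
  have "fps_nth (theta tri (\<lambda>_. 1) * f_prod 2) N = (\<Sum>(i, j)\<in>?S (\<lambda>i j. True). alt j)"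
    using theta_mult_nth[OF abs_le_tri e, of "\<lambda>_. 1" alt N] f_prod_eq_compose[of 2]
      theta_compose[of 2 pent alt] theta_pentagonal by simp
  also have "\<dots> = (\<Sum>(i, j)\<in>?S ?P1. alt j) + (\<Sum>(i, j)\<in>?S ?P2. alt j)"
    using fin disj unfolding split by (intro sum.union_disjoint) auto
  also have "(\<Sum>(i, j)\<in>?S ?P2. alt j) = (\<Sum>(i, j)\<in>?S ?P1. alt j)"
    by (rule sum.reindex_bij_witness[of _ "\<lambda>(i, j). (1 - i, j)" "\<lambda>(i, j). (1 - i, j)"])
      (auto simp: tri_def algebra_simps)
  also have "(\<Sum>(i, j)\<in>?S ?P1. alt j) = 0"
    by (rule triangular_pentagonal_sum_eq_0)
  finally show ?thesis
    by simp
qed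

text \<open>
  With \<open>x = 2 i - 1\<close> and \<open>y = 2 j - 1\<close> the exponents are governed by \<open>8 N + 2 = x\<^sup>2 + y\<^sup>2\<close>, and
  11 is inert in the Gaussian integers.
\<close>
lemma triangular_square_nth_eq_0:
  assumes "N mod 11 = 8" "N mod 121 \<noteq> 30"
  shows "fps_nth (theta tri (\<lambda>_. 1) ^ 2) N = 0"
proof -
  have "tri i + tri j \<noteq> N" for i j
  proof
    assume "tri i + tri j = N"
    then have N: "2 * int N = i * (i - 1) + j * (j - 1)"
      unfolding tri_int[symmetric] by auto
    have r: "k * (k - 1) mod 11 \<in> {0, 1, 2, 6, 9} \<or> k mod 11 = 6 \<and> k * (k - 1) mod 11 = 8" for k :: int
    proof -
      have aux: "q \<in> {0, 1, 2, 6, 9} \<or> r = 6 \<and> q = 8"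
        if "q = r * ((r - 1) mod 11) mod 11" "r \<in> {0,1,2,3,4,5,6,7,8,9,10}" for q r :: int
        using that by auto
      have "k * (k - 1) mod 11 = (k mod 11) * ((k mod 11 - 1) mod 11) mod 11"
        by (simp add: mod_simps)
      moreover have "k mod 11 \<in> {0,1,2,3,4,5,6,7,8,9,10}"
        by (auto simp: insert_iff) presburger
      ultimately show ?thesis
        by (rule aux)
    qed
    have "2 * int N mod 11 = 5"
      using assms(1) by presburger
    then have sum: "(i * (i - 1) mod 11 + j * (j - 1) mod 11) mod 11 = 5"
      by (simp add: N mod_simps)
    \<comment> \<open>Among the possible residues, 5 arises only as \<open>8 + 8\<close>, which
      means that 11 divides both \<open>2 * i - 1\<close> and \<open>2 * j - 1\<close>; the base
      point is \<open>tri 6 + tri 6 = 30\<close>.\<close>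
    have aux: "a = 8 \<and> b = 8" if "(a + b) mod 11 = 5" "a \<in> {0, 1, 2, 6, 9} \<or> a = 8" "b \<in> {0, 1, 2, 6, 9} \<or> b = 8"
      for a b :: int
      using that by auto
    have "i * (i - 1) mod 11 = 8 \<and> j * (j - 1) mod 11 = 8"
      by (rule aux[OF sum]) (use r in blast)+
    then have "i mod 11 = 6" "j mod 11 = 6"
      using r[of i] r[of j] by simp_all
    then obtain u v where "i = 6 + 11 * u" "j = 6 + 11 * v"
      by (metis mod_div_decomp add.commute mult.commute)
    then have "2 * int N = 2 * int 30 + 121 * (u + u * u + v + v * v)"
      using N by (simp add: algebra_simps)
    from mod_121_of_double[OF this] show False
      using assms(2) by simp
  qed
  then show ?thesis
    using theta_mult_nth[OF abs_le_tri abs_le_tri, of "\<lambda>_. 1" "\<lambda>_. 1" N] by (simp add: power2_eq_square)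
qed

section \<open>Combining the theta factors with Ramanujan's congruence\<close>

lemma fps_power_121_cong: "ring_cong 11 (A ^ 121) (A oo fps_X ^ 121)" for A :: "int fps"
proof -
  have "A ^ 121 = (A ^ 11) ^ 11"
    by (simp flip: power_mult)
  also have "ring_cong 11 \<dots> ((A oo fps_X ^ 11) ^ 11)"
    by (intro ring_cong_power fps_power_11_cong)
  also have "ring_cong 11 \<dots> ((A oo fps_X ^ 11) oo fps_X ^ 11)"
    by (rule fps_power_11_cong)
  also have "\<dots> = A oo fps_X ^ 121"
    by (simp add: fps_compose_X_power_compose)
  finally show ?thesis .
qed

text \<open>A contributing term has \<open>M = 11 * l * u + 121 * v\<close>. If 11 does not divide
  \<open>M\<close> there is none; otherwise the residue \<open>66 * l\<close> forces
  \<open>u\<close> to be 6 modulo 11, where \<open>ramanujan_11\<close> applies.\<close>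

lemma partition_factor_nth_dvd:
  assumes "l \<in> {1, 2}" "M mod 11 \<noteq> 0 \<or> M mod 121 = (66 * l) mod 121"
  shows "11 dvd fps_nth ((p_ser oo fps_X ^ (11 * l)) * (R oo fps_X ^ 121)) M"
  unfolding fps_mult_nth
proof (intro dvd_sum)
  fix i assume i: "i \<in> {0..M}"
  show "11 dvd fps_nth (p_ser oo fps_X ^ (11 * l)) i * fps_nth (R oo fps_X ^ 121) (M - i)"
  proof (cases "11 * l dvd i \<and> 121 dvd M - i")
    case True
    then obtain u v where "i = 11 * l * u" "M - i = 121 * v"
      by (auto elim!: dvdE)
    then have M: "M = 11 * (l * u + 11 * v)"
      using i by auto
    then have "(11 * (l * u + 11 * v)) mod (11 * 11) = (66 * l) mod 121"
      using assms(2) by auto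
    then have "11 * ((l * u) mod 11) = (66 * l) mod 121"
      unfolding mult_mod_right[symmetric] by simp
    then have "u mod 11 = 6"
      using assms(1) by auto presburger
    then have "u = 11 * (u div 11) + 6"
      by presburger
    then have "11 dvd fps_nth p_ser u"
      using ramanujan_11 by metis
    then show ?thesis
      using \<open>i = 11 * l * u\<close> assms(1) by (auto simp: fps_compose_X_power_nth)
  next
    case False
    then show ?thesis
      using assms(1) by (auto simp: fps_compose_X_power_nth)
  qed
qed

lemma nth_mult_dvd:
  assumes "\<And>i. i \<le> n \<Longrightarrow> fps_nth A i = 0 \<or> k dvd fps_nth B (n - i)"
  shows "k dvd fps_nth (A * B :: int fps) n"
  unfolding fps_mult_nth using assms by (intro dvd_sum) (auto dest!: assms)

text \<open>For splitting the target index between the theta factor (\<open>i\<close>) and the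
  partition factor (\<open>m\<close>): the exceptional class \<open>s\<close> of the former
  corresponds to the class \<open>t - s\<close> of the latter.\<close>

lemma mod_11_121_transfer:
  fixes i m n t s :: nat
  assumes "i + m = 121 * n + t" "m mod 11 = 0" "s \<le> t"
  shows "i mod 11 = t mod 11" and "i mod 121 = s \<Longrightarrow> m mod 121 = (t - s) mod 121"
proof -
  obtain w where "m = 11 * w"
    using assms(2) by auto
  then have "(i + 11 * w) mod 11 = (t + 11 * (11 * n)) mod 11"
    using assms(1) by (simp add: add.commute)
  then show "i mod 11 = t mod 11"
    unfolding mod_mult_self2 .
next
  assume "i mod 121 = s"
  then have "i = s + 121 * (i div 121)"
    by (metis add.commute mult_div_mod_eq)
  then have "m + 121 * (i div 121) = (t - s) + 121 * n"
    using assms by linarith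
  then show "m mod 121 = (t - s) mod 121"
    by (metis mod_mult_self2)
qed

lemma a_cubic_dvd: "11 dvd a_cubic (121 * c + 9) (121 * n + 36)"
proof -
  define A where "A = Abs_fps (\<lambda>n. int (a_cubic (121 * c + 9) n))"
  define f1 f2 P where "f1 = f_prod 1" and "f2 = f_prod 2" and "P = p_ser oo fps_X ^ 2"
  define G where "G = theta tri (\<lambda>_. 1) * f2"
  define B where "B = (p_ser oo fps_X ^ (11 * 2)) * (P ^ c oo fps_X ^ 121)"
  have 1: "f1 * p_ser = 1"
    using f_prod_p_ser[of 1] by (simp add: f1_def)
  have 2: "f2 * P = 1"
    using f_prod_p_ser[of 2] by (simp add: f2_def P_def)
  have "A * (f1 * f2 ^ (121 * c + 8)) = 1"
    using a_cubic_generating_function[of "121 * c + 9"] by (simp add: A_def f1_def f2_def add.commute)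
  \<comment> \<open>Division is replaced by inserting products equal to 1.\<close>
  then have "A = A * (f1 * f2 ^ (121 * c + 8)) * A * (f1 * p_ser) * (f2 * P) ^ (121 * c + 8)"
    by (simp add: 1 2)
  also have "\<dots> = (A * (f1 * f2 ^ (121 * c + 8))) * (A * (f1 * f2 ^ (121 * c + 8))) * (p_ser * P ^ (121 * c + 8))"
    by (simp only: power_mult_distrib mult_ac)
  \<comment> \<open>The inserted cube supplies the \<open>f2 ^ 3\<close> needed for
    \<open>G = 2 * f2 ^ 3 * p_ser\<close> and raises the exponent of \<open>P\<close> from
    \<open>121 * c + 8\<close> to \<open>121 * c + 11\<close>.\<close>
  also have "\<dots> = p_ser * P ^ (121 * c + 8) * (f2 * P) ^ 3"
    by (simp add: \<open>A * (f1 * f2 ^ (121 * c + 8)) = 1\<close> 2)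
  finally have "2 * A = 2 * (p_ser * P ^ (121 * c + 8) * (f2 * P) ^ 3)"
    by simp
  also have "\<dots> = G * (P ^ 11 * (P ^ c) ^ 121)"
    unfolding G_def theta_triangular by (simp add: f2_def power_mult_distrib mult_ac power_add flip: power_mult power_Suc)
  also have "ring_cong 11 \<dots> (G * ((P oo fps_X ^ 11) * (P ^ c oo fps_X ^ 121)))"
    by (intro ring_cong_mult ring_cong_refl fps_power_11_cong fps_power_121_cong)
  also have "P oo fps_X ^ 11 = p_ser oo fps_X ^ (11 * 2)"
    by (simp add: P_def fps_compose_X_power_compose)
  finally have "11 dvd fps_nth (2 * A - G * B) (121 * n + 36)"
    by (simp add: ring_cong_def numeral_fps_dvd_iff B_def)
  moreover have "11 dvd fps_nth (G * B) (121 * n + 36)"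
  proof (rule nth_mult_dvd)
    fix i assume i: "i \<le> 121 * n + 36"
    show "fps_nth G i = 0 \<or> 11 dvd fps_nth B (121 * n + 36 - i)"
    \<comment> \<open>Here \<open>l = 2\<close>, and 11 is \<open>66 * 2\<close> modulo 121. It is
      also \<open>36 - 25\<close>, the class complementary to the exceptional one of
      \<open>G\<close>.\<close>
    proof (cases "(121 * n + 36 - i) mod 11 \<noteq> 0 \<or> (121 * n + 36 - i) mod 121 = 11")
      case True
      then show ?thesis
        using partition_factor_nth_dvd[of 2 "121 * n + 36 - i"] by (simp add: B_def)
    next
      case False
      then have "i mod 11 = 3" "i mod 121 \<noteq> 25"
        using i mod_11_121_transfer[of i "121 * n + 36 - i" n 36 25] by auto
      then show ?thesis
        using triangular_pentagonal_nth_eq_0 by (simp add: G_def f2_def)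
    qed
  qed
  ultimately have "11 dvd fps_nth (2 * A - G * B) (121 * n + 36) + fps_nth (G * B) (121 * n + 36)"
    by (rule dvd_add)
  then have "11 dvd 2 * int (a_cubic (121 * c + 9) (121 * n + 36))"
    by (simp add: A_def numeral_fps_const)
  then show ?thesis
    by presburger
qed

lemma d_diamond_dvd: "11 dvd d_diamond (121 * c + 4) (121 * n + 96)"
proof -
  define k where "k = 121 * c + 4"
  define D where "D = Abs_fps (d_diamond k)"
  define f1 f2 where "f1 = f_prod 1" and "f2 = f_prod 2"
  define G where "G = theta tri (\<lambda>_. 1) ^ 2"
  define R where "R = f2 ^ c * p_ser ^ (3 * c)"
  define B where "B = (p_ser oo fps_X ^ (11 * 1)) * (R oo fps_X ^ 121)"
  have 1: "f1 * p_ser = 1"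
    using f_prod_p_ser[of 1] by (simp add: f1_def)
  have "D = D * (f1 * p_ser) ^ (3 * k + 1)"
    by (simp add: 1)
  also have "\<dots> = D * f1 ^ (3 * k + 1) * p_ser ^ (3 * k + 1)"
    by (simp only: power_mult_distrib mult.assoc)
  also have "\<dots> = f2 ^ k * p_ser ^ (3 * k + 1)"
    unfolding D_def f1_def f2_def d_diamond_generating_function ..
  finally have "4 * D = 4 * (f2 ^ k * p_ser ^ (3 * k + 1))"
    by simp
  \<comment> \<open>The exponent \<open>3 * k + 1 = 363 * c + 13\<close> of \<open>p_ser\<close>
    splits as 2 for \<open>G\<close>, 11, and \<open>121 * (3 * c)\<close> for
    \<open>R ^ 121\<close>; squaring the theta series brings in the factor 4.\<close>
  also have "\<dots> = G * (p_ser ^ 11 * R ^ 121)"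
    unfolding G_def theta_triangular R_def k_def
    by (simp add: f2_def power_mult_distrib mult_ac power_add flip: power_mult power_Suc)
  also have "ring_cong 11 \<dots> (G * ((p_ser oo fps_X ^ 11) * (R oo fps_X ^ 121)))"
    by (intro ring_cong_mult ring_cong_refl fps_power_11_cong fps_power_121_cong)
  finally have "11 dvd fps_nth (4 * D - G * B) (121 * n + 96)"
    by (simp add: ring_cong_def numeral_fps_dvd_iff B_def)
  moreover have "11 dvd fps_nth (G * B) (121 * n + 96)"
  proof (rule nth_mult_dvd)
    fix i assume i: "i \<le> 121 * n + 96"
    show "fps_nth G i = 0 \<or> 11 dvd fps_nth B (121 * n + 96 - i)"
    \<comment> \<open>Here \<open>l = 1\<close>, and \<open>66 = 96 - 30\<close> is complementary to
      the exceptional class 30 of \<open>G\<close>.\<close>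
    proof (cases "(121 * n + 96 - i) mod 11 \<noteq> 0 \<or> (121 * n + 96 - i) mod 121 = 66")
      case True
      then show ?thesis
        using partition_factor_nth_dvd[of 1 "121 * n + 96 - i"] by (simp add: B_def)
    next
      case False
      then have "i mod 11 = 8" "i mod 121 \<noteq> 30"
        using i mod_11_121_transfer[of i "121 * n + 96 - i" n 96 30] by auto
      then show ?thesis
        using triangular_square_nth_eq_0 by (simp add: G_def)
    qed
  qed
  ultimately have "11 dvd fps_nth (4 * D - G * B) (121 * n + 96) + fps_nth (G * B) (121 * n + 96)"
    by (rule dvd_add)
  then have "11 dvd 4 * d_diamond (121 * c + 4) (121 * n + 96)"
    by (simp add: D_def k_def numeral_fps_const)
  then show ?thesis
    by presburger
qed

theorem theorem1p2:
  fixes c n :: nat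
  shows "[a_cubic (121 * c + 9) (121 * n + 36) = 0] (mod 11)
       \<and> [d_diamond (121 * c + 4) (121 * n + 96) = 0] (mod 11)"
  using a_cubic_dvd d_diamond_dvd by (simp add: cong_0_iff)

end
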